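(* Let $A$ be an $n\times n$ M-matrix with a factorization $A=LU$, where $L$ and $U$ are $n\times n$ M-matrices. Let $S_1,\dots,S_m$ be the singular classes of $A$, ordered so that $\max(S_i)<\max(S_{i+1})$, and let $F_i,T_i$ ($1\le i\le m$) be the associated sets defined in the context. Then for each $i\in\{1,\dots,m\}$ there is a subset $Q_i\subseteq S_i$ such that $Q_i$ is a singular class of $L$ or a singular class of $U$. Moreover, for such $Q_i\subseteq S_i$: if $Q_i$ is a singular class of $L$, then $F_i$ is encompassed in the block lower triangular self-partition of $L$; if $Q_i$ is a singular class of $U$, then $T_i$ is encompassed in the block upper triangular self-partition of $U$.
   Context: All matrices are real $n\times n$, and $\langle n\rangle=\{1,\dots,n\}$. An M-matrix is a matrix of the form $\alpha I-P$ with $P$ entrywise nonnegative and $\alpha\in\mathbb{R}$ at least the spectral radius of $P$ (so M-matrices may be singular). Graphs. The directed graph $\mathcal{G}(X)$ of $X=[x_{ij}]$ has vertex set $\langle n\rangle$ and edges $\{(i,j): x_{ij}\neq 0\}$. A vertex $j$ has access to $k$ (equivalently, $k$ is accessed from $j$) if there is a directed path from $j$ to $k$; the empty path is allowed, so every vertex has access to itself. The classes of $X$ are the equivalence classes of the relation "$j$ has access to $k$ and $k$ has access to $j$" in $\mathcal{G}(X)$. For $J,K\subseteq\langle n\rangle$, $X_{JK}$ is the submatrix with rows indexed by $J$ and columns indexed by $K$ (in ascending order). A class $J$ of $X$ is a singular class of $X$ if $X_{JJ}$ is singular. A vertex has access to (is accessed from) a class if it has access to (is accessed from) some vertex of it.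 Sets $F_i,T_i$. With $S_1,\dots,S_m$ the singular classes of $A$ ordered by $\max(S_i)<\max(S_{i+1})$ and $\mu_i=\max(S_i)$, $$F_i=\{l\ge\mu_i : \text{there is } j\ge l \text{ such that } j \text{ is accessed from } S_i \text{ in } \mathcal{G}(A)\},$$ $$T_i=\{l\ge\mu_i : \text{there is } j\ge l \text{ such that } j \text{ has access to } S_i \text{ in } \mathcal{G}(A)\}.$$ Partitions. An order preserving partition of $\langle n\rangle$ is a sequence $\Upsilon=(\upsilon_1,\dots,\upsilon_r)$ of pairwise disjoint sets with union $\langle n\rangle$ such that $i<j$, $i\in\upsilon_{k}$, $j\in\upsilon_{k'}$ imply $k\le k'$ (i.e. a partition into consecutive intervals). $\Psi$ is a refinement of $\Upsilon$ if both are order preserving partitions and each block of $\Psi$ is contained in a block of $\Upsilon$ (not necessarily properly). Order preserving partitions form a lattice under refinement, the greatest lower bound of two partitions having as elements the intersections of their elements. For a set $\upsilon$, let $\upsilon^+=\{l\in\langle n\rangle: l>\max(\upsilon)\}$. The block lower triangular self-partition of $X$ is the greatest lower bound (finest) of the order preserving partitions $\Upsilon$ with $X_{\upsilon_i\upsilon_i^+}=0$ for all $i$; the block upper triangular self-partition of $X$ is the greatest lower bound (finest) of the order preserving partitions $\Upsilon$ with $X_{\upsilon_i^+\upsilon_i}=0$ for all $i$. An order preserving partition encompasses a set $J\subseteq\langle n\rangle$ (and $J$ is encompassed in it) if $J$ is contained in one of its blocks. *)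

theory Defs
  imports
    "Jordan_Normal_Form.Spectral_Radius"
    "Jordan_Normal_Form.DL_Submatrix"
begin

text \<open>
  The index set of an \<open>n \<times> n\<close> matrix is \<open>{0..<n}\<close>, in place of \<open>{1..n}\<close>.
\<close>

definition M_matrix :: "nat \<Rightarrow> real mat \<Rightarrow> bool" where
  "M_matrix n X \<longleftrightarrow> (\<exists>(\<alpha>::real) P. P \<in> carrier_mat n n \<and>
     (\<forall>i<n. \<forall>j<n. 0 \<le> P $$ (i, j)) \<and>
     spectral_radius (map_mat complex_of_real P) \<le> \<alpha> \<and>
     X = \<alpha> \<cdot>\<^sub>m 1\<^sub>m n - P)"

definition mat_graph :: "real mat \<Rightarrow> (nat \<times> nat) set" where
  "mat_graph X = {(i, j). i < dim_row X \<and> j < dim_row X \<and> X $$ (i, j) \<noteq> 0}"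

definition has_access :: "real mat \<Rightarrow> nat \<Rightarrow> nat \<Rightarrow> bool" where
  "has_access X j k \<longleftrightarrow> (j, k) \<in> (mat_graph X)\<^sup>*"

definition access_classes :: "real mat \<Rightarrow> nat set set" where
  "access_classes X = {0..<dim_row X} //
     {(j, k). j < dim_row X \<and> k < dim_row X \<and> has_access X j k \<and> has_access X k j}"

definition singular_classes :: "real mat \<Rightarrow> nat set set" where
  "singular_classes X = {J \<in> access_classes X. det (submatrix X J J) = 0}"

definition F_set :: "real mat \<Rightarrow> nat set \<Rightarrow> nat set" where
  "F_set A S = {l. l < dim_row A \<and> Max S \<le> l \<and>
     (\<exists>j. j < dim_row A \<and> l \<le> j \<and> (\<exists>s\<in>S. has_access A s j))}"

definition T_set :: "real mat \<Rightarrow> nat set \<Rightarrow> nat set" where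
  "T_set A S = {l. l < dim_row A \<and> Max S \<le> l \<and>
     (\<exists>j. j < dim_row A \<and> l \<le> j \<and> (\<exists>s\<in>S. has_access A j s))}"

text \<open>
  Blocks are required to be nonempty, as usual for partitions; this also makes \<open>Max\<close> of a block
  meaningful and a partition determined by its set of blocks.
\<close>

definition order_preserving_partition :: "nat \<Rightarrow> nat set list \<Rightarrow> bool" where
  "order_preserving_partition n Y \<longleftrightarrow>
     {} \<notin> set Y \<and>
     (\<forall>k<length Y. \<forall>k'<length Y. k \<noteq> k' \<longrightarrow> Y ! k \<inter> Y ! k' = {}) \<and>
     \<Union> (set Y) = {0..<n} \<and>
     (\<forall>k<length Y. \<forall>k'<length Y. \<forall>i\<in>Y ! k. \<forall>j\<in>Y ! k'. i < j \<longrightarrow> k \<le> k')"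

definition refinement :: "nat \<Rightarrow> nat set list \<Rightarrow> nat set list \<Rightarrow> bool" where
  "refinement n X Y \<longleftrightarrow>
     order_preserving_partition n X \<and> order_preserving_partition n Y \<and>
     (\<forall>x\<in>set X. \<exists>y\<in>set Y. x \<subseteq> y)"

definition is_partition_glb :: "nat \<Rightarrow> nat set list set \<Rightarrow> nat set list \<Rightarrow> bool" where
  "is_partition_glb n PP G \<longleftrightarrow> order_preserving_partition n G \<and>
     (\<forall>Y\<in>PP. refinement n G Y) \<and>
     (\<forall>H. order_preserving_partition n H \<and> (\<forall>Y\<in>PP. refinement n H Y) \<longrightarrow> refinement n H G)"

definition partition_glb :: "nat \<Rightarrow> nat set list set \<Rightarrow> nat set list" where
  "partition_glb n PP = (THE G. is_partition_glb n PP G)"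

definition above :: "nat \<Rightarrow> nat set \<Rightarrow> nat set" where
  "above n v = {l. l < n \<and> Max v < l}"

definition lower_self_partition :: "real mat \<Rightarrow> nat set list" where
  "lower_self_partition X = partition_glb (dim_row X)
     {Y. order_preserving_partition (dim_row X) Y \<and>
         (\<forall>v\<in>set Y. \<forall>a\<in>v. \<forall>b\<in>above (dim_row X) v. X $$ (a, b) = 0)}"

definition upper_self_partition :: "real mat \<Rightarrow> nat set list" where
  "upper_self_partition X = partition_glb (dim_row X)
     {Y. order_preserving_partition (dim_row X) Y \<and>
         (\<forall>v\<in>set Y. \<forall>a\<in>above (dim_row X) v. \<forall>b\<in>v. X $$ (a, b) = 0)}"

definition encompasses :: "nat set list \<Rightarrow> nat set \<Rightarrow> bool" where
  "encompasses Y J \<longleftrightarrow> (\<exists>v\<in>set Y. J \<subseteq> v)"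

lemma opp_blocks_eq:
  assumes "order_preserving_partition n Y" "u \<in> set Y" "v \<in> set Y" "x \<in> u" "x \<in> v"
  shows "u = v"
  using assms unfolding order_preserving_partition_def in_set_conv_nth by blast

lemma opp_block_of:
  assumes "order_preserving_partition n Y" "x < n"
  obtains v where "v \<in> set Y" "x \<in> v"
  using assms unfolding order_preserving_partition_def
  by (metis UnionE atLeastLessThan_iff le0)

lemma opp_convex:
  assumes Y: "order_preserving_partition n Y" and "v \<in> set Y" "x \<in> v" "z \<in> v" "x \<le> y" "y \<le> z"
  shows "y \<in> v"
proof (cases "x = y \<or> y = z")
  case True
  then show ?thesis using assms by auto
next
  case False
  have "z < n" using assms unfolding order_preserving_partition_def by auto
  then obtain w where w: "w \<in> set Y" "y \<in> w"
    using opp_block_of[OF Y, of y] \<open>y \<le> z\<close> by auto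
  obtain i j where ij: "i < length Y" "j < length Y" "v = Y ! i" "w = Y ! j"
    using w assms(2) by (metis in_set_conv_nth)
  have "i \<le> j" "j \<le> i"
    using Y ij w assms False unfolding order_preserving_partition_def
    by (metis le_neq_implies_less)+
  then show ?thesis using ij w by simp
qed

lemma opp_sorted_Max:
  assumes Y: "order_preserving_partition n Y"
  shows "sorted_wrt (<) (map Max Y)"
proof -
  have "Max (Y ! i) < Max (Y ! j)" if ij: "i < j" "j < length Y" for i j
  proof -
    have fin: "finite v" "v \<noteq> {}" if "v \<in> set Y" for v
    proof -
      have "v \<subseteq> {0..<n}" "v \<noteq> {}"
        using Y that unfolding order_preserving_partition_def by blast+
      then show "finite v" "v \<noteq> {}" using finite_subset by blast+
    qed
    have m: "Max (Y ! i) \<in> Y ! i" "Max (Y ! j) \<in> Y ! j"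
      using fin ij by (auto intro!: Max_in)
    have "Y ! i \<inter> Y ! j = {}"
      using Y ij unfolding order_preserving_partition_def by auto
    then have "Max (Y ! i) \<noteq> Max (Y ! j)" using m by auto
    moreover have "\<not> Max (Y ! j) < Max (Y ! i)"
    proof
      assume "Max (Y ! j) < Max (Y ! i)"
      then have "j \<le> i" using Y ij m unfolding order_preserving_partition_def
        by (meson less_trans)
      then show False using ij by simp
    qed
    ultimately show ?thesis by simp
  qed
  then show ?thesis by (simp add: sorted_wrt_iff_nth_less)
qed

lemma opp_eqI:
  assumes X: "order_preserving_partition n X" and Y: "order_preserving_partition n Y"
    and "set X = set Y"
  shows "X = Y"
proof -
  have "map Max X = map Max Y"
    using strict_sorted_equal[OF opp_sorted_Max[OF X] opp_sorted_Max[OF Y]] assms by simp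
  moreover have "inj_on Max (set X \<union> set Y)"
  proof -
    have "inj_on Max (set X)"
      using opp_sorted_Max[OF X] strict_sorted_iff distinct_map by blast
    then show ?thesis using assms by simp
  qed
  ultimately show ?thesis using map_inj_on by blast
qed

lemma refinement_antisym:
  assumes "refinement n X Y" "refinement n Y X"
  shows "X = Y"
proof -
  have sub: "set X \<subseteq> set Y" if XY: "refinement n X Y" "refinement n Y X" for X Y
  proof
    fix x assume x: "x \<in> set X"
    obtain y where y: "y \<in> set Y" "x \<subseteq> y" using XY x unfolding refinement_def by blast
    obtain x' where x': "x' \<in> set X" "y \<subseteq> x'" using XY y unfolding refinement_def by blast
    have "x \<noteq> {}" using XY x unfolding refinement_def order_preserving_partition_def by auto
    then have "x = x'" using opp_blocks_eq[of n X x x'] x x' y XY unfolding refinement_def by blast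
    then show "x \<in> set Y" using x' y by auto
  qed
  then have "set X = set Y" using assms by blast
  moreover have "order_preserving_partition n X" "order_preserving_partition n Y"
    using assms unfolding refinement_def by simp_all
  ultimately show ?thesis using opp_eqI by metis
qed

lemma partition_glb_exists:
  assumes PP: "\<And>Y. Y \<in> PP \<Longrightarrow> order_preserving_partition n Y"
  shows "\<exists>G. is_partition_glb n PP G"
proof -
  define B where "B x = {y. y < n \<and> (\<forall>Y\<in>PP. \<forall>v\<in>set Y. x \<in> v \<longleftrightarrow> y \<in> v)}" for x
  define R where "R = {x. x < n \<and> (\<forall>y\<in>B x. x \<le> y)}"
  define G where "G = map B (sorted_list_of_set R)"
  have finR: "finite R" unfolding R_def by simp
  have B_self: "x < n \<Longrightarrow> x \<in> B x" for x unfolding B_def by simp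
  have B_eq: "B x = B y" if "y \<in> B x" for x y using that unfolding B_def by auto
  have B_conv: "y \<in> B x" if "z \<in> B x" "x \<le> y" "y \<le> z" for x y z
  proof -
    have "x \<in> v \<longleftrightarrow> y \<in> v" if "Y \<in> PP" "v \<in> set Y" for Y v
    proof
      assume x: "x \<in> v"
      then have "z \<in> v" using \<open>z \<in> B x\<close> that unfolding B_def by blast
      then show "y \<in> v"
        by (rule opp_convex[OF PP[OF \<open>Y \<in> PP\<close>] \<open>v \<in> set Y\<close> x _ \<open>x \<le> y\<close> \<open>y \<le> z\<close>])
    next
      assume y: "y \<in> v"
      have "x < n" using \<open>z \<in> B x\<close> \<open>x \<le> y\<close> \<open>y \<le> z\<close> unfolding B_def by auto
      then obtain w where w: "w \<in> set Y" "x \<in> w" using opp_block_of[OF PP[OF \<open>Y \<in> PP\<close>]] by blast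
      then have "z \<in> w" using \<open>z \<in> B x\<close> that unfolding B_def by blast
      then have "y \<in> w"
        by (rule opp_convex[OF PP[OF \<open>Y \<in> PP\<close>] w(1) w(2) _ \<open>x \<le> y\<close> \<open>y \<le> z\<close>])
      then have "w = v" using opp_blocks_eq[OF PP[OF \<open>Y \<in> PP\<close>] w(1) \<open>v \<in> set Y\<close>] y by blast
      then show "x \<in> v" using w by simp
    qed
    moreover have "y < n" using \<open>z \<in> B x\<close> \<open>y \<le> z\<close> unfolding B_def by simp
    ultimately show ?thesis unfolding B_def by blast
  qed
  have setG: "set G = B ` R" unfolding G_def using finR by simp
  have rep: "\<exists>r\<in>R. B r = B x" if "x < n" for x
  proof -
    have fin: "finite (B x)" "B x \<noteq> {}" using B_self[OF that] unfolding B_def by auto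
    have M: "Min (B x) \<in> B x" using fin by simp
    then have eq: "B (Min (B x)) = B x" using B_eq by metis
    have "Min (B x) < n" using M unfolding B_def by blast
    moreover have "\<forall>y\<in>B x. Min (B x) \<le> y" using fin by simp
    ultimately have "Min (B x) \<in> R" unfolding R_def by (simp add: eq)
    then show ?thesis using eq by blast
  qed
  have nthG: "G ! k = B (sorted_list_of_set R ! k)" "sorted_list_of_set R ! k \<in> R"
    if "k < length G" for k
    using that finR nth_mem[of k "sorted_list_of_set R"] unfolding G_def by auto
  have mono: "sorted_list_of_set R ! i < sorted_list_of_set R ! j" if "i < j" "j < length G" for i j
    using that strict_sorted_list_of_set[of R] unfolding G_def sorted_wrt_iff_nth_less by simp
  have R_uniq: "r = s" if "r \<in> R" "s \<in> R" "B r = B s" for r s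
    using that B_self[of r] B_self[of s] unfolding R_def by (auto intro: antisym)
  have order: "k \<le> k'" if "k < length G" "k' < length G" "i \<in> G ! k" "j \<in> G ! k'" "i < j" for k k' i j
  proof (rule ccontr)
    assume "\<not> k \<le> k'"
    define r s where "r = sorted_list_of_set R ! k" and "s = sorted_list_of_set R ! k'"
    have "s < r" using mono \<open>\<not> k \<le> k'\<close> that unfolding r_def s_def by simp
    have rs: "r \<in> R" "s \<in> R" "i \<in> B r" "j \<in> B s" using nthG that unfolding r_def s_def by auto
    then have "r \<le> i" unfolding R_def by auto
    then have "r \<in> B s" using B_conv[OF rs(4)] \<open>s < r\<close> \<open>i < j\<close> by simp
    then have "r = s" using R_uniq rs B_eq by metis
    then show False using \<open>s < r\<close> by simp
  qed
  have disj: "G ! k \<inter> G ! k' = {}" if "k < length G" "k' < length G" "k \<noteq> k'" for k k'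
  proof (rule ccontr)
    assume "G ! k \<inter> G ! k' \<noteq> {}"
    then have "B (sorted_list_of_set R ! k) = B (sorted_list_of_set R ! k')"
      using nthG that B_eq by (metis disjoint_iff)
    then have "sorted_list_of_set R ! k = sorted_list_of_set R ! k'"
      using R_uniq nthG that by blast
    then show False using mono that by (metis less_irrefl linorder_neqE_nat)
  qed
  have Un: "\<Union> (set G) = {0..<n}"
  proof
    have "B r \<subseteq> {0..<n}" for r unfolding B_def by auto
    then show "\<Union> (set G) \<subseteq> {0..<n}" unfolding setG by blast
    show "{0..<n} \<subseteq> \<Union> (set G)"
    proof
      fix x assume "x \<in> {0..<n}"
      then have "x < n" by simp
      then obtain r where "r \<in> R" "B r = B x" using rep by blast
      then show "x \<in> \<Union> (set G)" unfolding setG using B_self[OF \<open>x < n\<close>] by blast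
    qed
  qed
  have "r < n" if "r \<in> R" for r using that unfolding R_def by simp
  then have ne: "{} \<notin> set G" unfolding setG using B_self by blast
  have opp: "order_preserving_partition n G"
    unfolding order_preserving_partition_def by (intro conjI ne Un allI impI ballI; (rule disj | rule order); assumption)
  have low: "refinement n G Y" if Y: "Y \<in> PP" for Y
    unfolding refinement_def
  proof (intro conjI ballI)
    show "order_preserving_partition n G" by (fact opp)
    show "order_preserving_partition n Y" using PP Y .
    fix x assume "x \<in> set G"
    then obtain r where r: "r \<in> R" "x = B r" unfolding setG by blast
    then have "r < n" unfolding R_def by simp
    then obtain v where "v \<in> set Y" "r \<in> v" using opp_block_of[OF PP[OF Y]] by blast
    then show "\<exists>y\<in>set Y. x \<subseteq> y" using r Y unfolding B_def by blast
  qed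
  have great: "refinement n H G"
    if H: "order_preserving_partition n H" "\<forall>Y\<in>PP. refinement n H Y" for H
    unfolding refinement_def
  proof (intro conjI ballI)
    show "order_preserving_partition n H" by (fact H)
    show "order_preserving_partition n G" by (fact opp)
    fix x assume x: "x \<in> set H"
    then have "x \<noteq> {}" using H(1) unfolding order_preserving_partition_def by metis
    then obtain a where a: "a \<in> x" by blast
    have lt: "y < n" if "y \<in> x" for y
      using H(1) x that unfolding order_preserving_partition_def by auto
    have "x \<subseteq> B a"
    proof
      fix b assume b: "b \<in> x"
      have "a \<in> v \<longleftrightarrow> b \<in> v" if Y: "Y \<in> PP" "v \<in> set Y" for Y v
      proof -
        obtain w where w: "w \<in> set Y" "x \<subseteq> w" using H Y x unfolding refinement_def by blast
        then show ?thesis using opp_blocks_eq[OF PP[OF Y(1)] w(1) Y(2)] a b by blast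
      qed
      then show "b \<in> B a" using lt[OF b] unfolding B_def by blast
    qed
    moreover obtain r where "r \<in> R" "B r = B a" using rep[OF lt[OF a]] by blast
    ultimately show "\<exists>y\<in>set G. x \<subseteq> y" unfolding setG by blast
  qed
  show ?thesis unfolding is_partition_glb_def using opp low great by blast
qed

lemma is_partition_glb_partition_glb:
  assumes "\<And>Y. Y \<in> PP \<Longrightarrow> order_preserving_partition n Y"
  shows "is_partition_glb n PP (partition_glb n PP)"
  unfolding partition_glb_def
proof (rule theI')
  have "G = H" if "is_partition_glb n PP G" "is_partition_glb n PP H" for G H
    using that unfolding is_partition_glb_def by (intro refinement_antisym[of n]) simp_all
  then show "\<exists>!G. is_partition_glb n PP G"
    using partition_glb_exists[OF assms] by blast
qed

end

theory Submission
  imports Defs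
begin

text \<open>
  Two facts carry the proof. Both rest on perturbing the factors by a diagonal matrix \<open>D \<ge> 0\<close>, which
  keeps the entries of \<open>(L + D)(U + D)\<close> off the diagonal nonpositive, because those of \<open>A\<close>, \<open>L D\<close>
  and \<open>D U\<close> are.

  The first is that a singular class \<open>S\<close> of \<open>A\<close> contains a singular class of \<open>L\<close> or of \<open>U\<close>. Take for
  \<open>D\<close> the indicator of the complement of \<open>S\<close>. For an M-matrix \<open>X\<close>, the matrix \<open>X + D\<close> is monotone
  unless \<open>X\<close> has a singular class inside \<open>S\<close> (\<open>monotone_if_no_singular_class\<close>). If neither factor has
  one, then \<open>(L + D)(U + D)\<close> is monotone, which is impossible because its principal submatrix on \<open>S\<close>
  is that of \<open>A\<close> (\<open>singular_class_of_some_factor\<close>).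

  The second is that a vertex with access in \<open>A\<close> to a singular class \<open>Q\<close> of \<open>U\<close> has access to \<open>Q\<close>
  already in \<open>U\<close> (\<open>access_to_singular_class_of_right_factor\<close>). With \<open>D\<close> the indicator of the
  complement of \<open>Q\<close>, the matrix \<open>U + D\<close> has a null vector \<open>x \<ge> 0\<close> that is positive on \<open>Q\<close> and
  supported on vertices with access to \<open>Q\<close> in \<open>U\<close>. From \<open>(A + L D) x = L (U + D) x = 0\<close> and the signs
  of the entries, the support of \<open>x\<close> is closed under predecessors in the graph of \<open>A\<close>.

  If \<open>Q\<close> is contained in the class \<open>S\<close> of \<open>A\<close>, the largest vertex with access to \<open>S\<close> in \<open>A\<close> is thus
  joined by a path of \<open>U\<close> to a vertex of \<open>Q\<close>, which is at most \<open>Max S\<close>. No block boundary of a block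
  upper triangular partition of \<open>U\<close> can separate the two ends of such a path. The statement
  on \<open>F_set\<close> follows by transposition.
\<close>

section \<open>M-matrices: left vectors and transposition\<close>
lemma eigenvalue_of_smult:
  fixes A :: "complex mat"
  assumes A: "A \<in> carrier_mat n n" and c: "c \<noteq> 0" and k: "eigenvalue (c \<cdot>\<^sub>m A) k"
  shows "eigenvalue A (k / c)"
proof -
  from k obtain v where v: "v \<in> carrier_vec n" "v \<noteq> 0\<^sub>v n" "(c \<cdot>\<^sub>m A) *\<^sub>v v = k \<cdot>\<^sub>v v"
    using A unfolding eigenvalue_def eigenvector_def by auto
  have "A *\<^sub>v v = (k / c) \<cdot>\<^sub>v v"
  proof (rule eq_vecI)
    show "dim_vec (A *\<^sub>v v) = dim_vec ((k / c) \<cdot>\<^sub>v v)" using A v by auto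
    fix i assume i: "i < dim_vec ((k / c) \<cdot>\<^sub>v v)"
    then have "((c \<cdot>\<^sub>m A) *\<^sub>v v) $ i = k * v $ i" using v by auto
    moreover have "((c \<cdot>\<^sub>m A) *\<^sub>v v) $ i = c * (A *\<^sub>v v) $ i" using A v(1) i by simp
    ultimately have "c * (A *\<^sub>v v) $ i = k * v $ i" by simp
    then show "(A *\<^sub>v v) $ i = ((k / c) \<cdot>\<^sub>v v) $ i" using c i by (auto simp: field_simps)
  qed
  then show ?thesis using A v unfolding eigenvalue_def eigenvector_def by auto
qed

lemma bounded_scaled_powers:
  fixes P :: "real mat"
  assumes P: "P \<in> carrier_mat n n" and n: "n > 0"
    and \<gamma>: "spectral_radius (map_mat complex_of_real P) < \<gamma>"
  shows "0 < \<gamma>" "\<exists>c. \<forall>k. norm_bound (((1/\<gamma>) \<cdot>\<^sub>m P) ^\<^sub>m k) c"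
proof -
  let ?C = "map_mat complex_of_real"
  have PC: "?C P \<in> carrier_mat n n" using P by simp
  have "0 \<le> spectral_radius (?C P)"
    using spectral_radius_mem_max(1)[OF PC n] by (metis imageE norm_ge_zero)
  then show \<gamma>0: "0 < \<gamma>" using \<gamma> by simp
  define Q where "Q = (1/\<gamma>) \<cdot>\<^sub>m P"
  have Q: "Q \<in> carrier_mat n n" using P unfolding Q_def by simp
  then have QC: "?C Q \<in> carrier_mat n n" by simp
  have QP: "?C Q = complex_of_real (1/\<gamma>) \<cdot>\<^sub>m ?C P" unfolding Q_def by auto
  have "spectral_radius (?C Q) < 1"
  proof -
    obtain k where k: "eigenvalue (?C Q) k" "spectral_radius (?C Q) = norm k"
      using spectral_radius_mem_max(1)[OF QC n] unfolding spectrum_def by auto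
    have "eigenvalue (?C P) (k / complex_of_real (1/\<gamma>))"
      using eigenvalue_of_smult[OF PC _ k(1)[unfolded QP]] \<gamma>0 by simp
    then have "norm (k / complex_of_real (1/\<gamma>)) \<le> spectral_radius (?C P)"
      using spectral_radius_mem_max(2)[OF PC n] unfolding spectrum_def by auto
    moreover have "norm (k / complex_of_real (1/\<gamma>)) = norm k * \<gamma>" using \<gamma>0 by (simp add: norm_mult)
    ultimately have "norm k * \<gamma> < 1 * \<gamma>" using \<gamma> by simp
    then show ?thesis using \<gamma>0 k by simp
  qed
  from spectral_radius_jnf_norm_bound_less_1_upper_triangular[OF QC this]
  obtain c where c: "\<And>k. norm_bound (?C Q ^\<^sub>m k) c" by blast
  have "norm_bound (Q ^\<^sub>m k) c" for k
  proof -
    have "?C Q ^\<^sub>m k = ?C (Q ^\<^sub>m k)" by (rule of_real_hom.mat_hom_pow[OF Q, symmetric])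
    then show ?thesis using c[of k] unfolding norm_bound_def by auto
  qed
  then show "\<exists>c. \<forall>k. norm_bound (((1/\<gamma>) \<cdot>\<^sub>m P) ^\<^sub>m k) c" unfolding Q_def by blast
qed

lemma M_matrixE:
  assumes "M_matrix n X"
  obtains \<alpha> P where "P \<in> carrier_mat n n" "\<And>i j. i < n \<Longrightarrow> j < n \<Longrightarrow> 0 \<le> P $$ (i, j)"
    "spectral_radius (map_mat complex_of_real P) \<le> \<alpha>" "X \<in> carrier_mat n n"
    "\<And>i j. i < n \<Longrightarrow> j < n \<Longrightarrow> X $$ (i, j) = (if i = j then \<alpha> else 0) - P $$ (i, j)"
proof -
  from assms obtain \<alpha> :: real and P where P: "P \<in> carrier_mat n n" "\<forall>i<n. \<forall>j<n. 0 \<le> P $$ (i, j)"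
    "spectral_radius (map_mat complex_of_real P) \<le> \<alpha>" "X = \<alpha> \<cdot>\<^sub>m 1\<^sub>m n - P"
    unfolding M_matrix_def by blast
  then show thesis by (intro that[of P \<alpha>]) auto
qed

lemma M_matrix_carrier: "M_matrix n X \<Longrightarrow> X \<in> carrier_mat n n"
  by (elim M_matrixE)

lemma M_matrix_offdiag: "M_matrix n X \<Longrightarrow> i < n \<Longrightarrow> j < n \<Longrightarrow> i \<noteq> j \<Longrightarrow> X $$ (i, j) \<le> 0"
  by (elim M_matrixE) simp

lemma M_matrix_transpose:
  assumes "M_matrix n X"
  shows "M_matrix n (transpose_mat X)"
proof -
  from assms obtain \<alpha> :: real and P where P: "P \<in> carrier_mat n n" "\<forall>i<n. \<forall>j<n. 0 \<le> P $$ (i, j)"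
    "spectral_radius (map_mat complex_of_real P) \<le> \<alpha>" "X = \<alpha> \<cdot>\<^sub>m 1\<^sub>m n - P"
    unfolding M_matrix_def by blast
  let ?C = "map_mat complex_of_real"
  have PC: "?C P \<in> carrier_mat n n" "?C (transpose_mat P) \<in> carrier_mat n n" using P by simp_all
  have PT: "?C (transpose_mat P) = transpose_mat (?C P)" by (rule eq_matI) auto
  have "spectrum (?C (transpose_mat P)) = spectrum (?C P)"
    unfolding spectrum_root_char_poly[OF PC(1)] spectrum_root_char_poly[OF PC(2)]
    using char_poly_transpose_mat[OF PC(1)] by (simp add: PT)
  then have "spectral_radius (?C (transpose_mat P)) \<le> \<alpha>"
    using P(3) unfolding spectral_radius_def by simp
  moreover have "transpose_mat X = \<alpha> \<cdot>\<^sub>m 1\<^sub>m n - transpose_mat P" using P by auto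
  ultimately show ?thesis using P(1,2) unfolding M_matrix_def
    by (intro exI[of _ \<alpha>] exI[of _ "transpose_mat P"]) auto
qed

text \<open>
  The only consequence of the bound on the spectral radius that is needed: \<open>X + \<epsilon>I\<close> has a positive left
  vector with nonnegative image. The vector is a long enough partial sum of the Neumann series
  \<open>\<Sum>k. 1\<^sup>T(P/\<beta>)\<^sup>k\<close>, where \<open>X + \<epsilon>I = \<beta>I - P\<close> and \<open>1\<close> is the all-ones vector.
\<close>
lemma M_matrix_left_vector:
  assumes M: "M_matrix n X" and \<epsilon>: "0 < \<epsilon>"
  shows "\<exists>v. (\<forall>i<n. 0 < v i) \<and> (\<forall>j<n. 0 \<le> (\<Sum>i<n. v i * X $$ (i, j)) + \<epsilon> * v j)"
proof (cases "n = 0")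
  case False
  then have n: "n > 0" by simp
  obtain \<alpha> P where P: "P \<in> carrier_mat n n"
    "\<And>i j. i < n \<Longrightarrow> j < n \<Longrightarrow> 0 \<le> P $$ (i, j)"
    "spectral_radius (map_mat complex_of_real P) \<le> \<alpha>"
    and X: "\<And>i j. i < n \<Longrightarrow> j < n \<Longrightarrow> X $$ (i, j) = (if i = j then \<alpha> else 0) - P $$ (i, j)"
    by (rule M_matrixE[OF M]) blast
  \<comment> \<open>The powers of \<open>Q = P/\<gamma>\<close> are bounded; passing from \<open>\<gamma>\<close> to the larger \<open>\<beta>\<close> makes the series geometric.\<close>
  define \<gamma> \<beta> where "\<gamma> = \<alpha> + \<epsilon> / 2" and "\<beta> = \<alpha> + \<epsilon>"
  have "spectral_radius (map_mat complex_of_real P) < \<gamma>" using P(3) \<epsilon> unfolding \<gamma>_def by simp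
  note B = bounded_scaled_powers[OF P(1) n this]
  define Q where "Q = (1/\<gamma>) \<cdot>\<^sub>m P"
  obtain c where c: "\<And>k. norm_bound (Q ^\<^sub>m k) c" using B(2) unfolding Q_def by blast
  have Q: "Q \<in> carrier_mat n n" using P unfolding Q_def by simp
  have QP: "P $$ (i, j) = \<gamma> * Q $$ (i, j)" if "i < n" "j < n" for i j
    using that P(1) B(1) unfolding Q_def by simp
  have Qk: "Q ^\<^sub>m k \<in> carrier_mat n n" for k using Q by simp
  define \<theta> where "\<theta> = \<gamma> / \<beta>"
  have \<beta>: "0 < \<beta>" "\<gamma> < \<beta>" using B(1) \<epsilon> unfolding \<beta>_def \<gamma>_def by simp_all
  have \<theta>: "0 < \<theta>" "\<theta> < 1" using B(1) \<beta> unfolding \<theta>_def by simp_all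
  \<comment> \<open>\<open>W k\<close> is the row vector \<open>1\<^sup>T Q\<^sup>k\<close>.\<close>
  define W where "W k j = (\<Sum>i<n. (Q ^\<^sub>m k) $$ (i, j))" for k j
  have W0: "W 0 j = 1" if "j < n" for j
  proof -
    have "W 0 j = (\<Sum>i<n. if i = j then 1 else 0)"
      unfolding W_def using Q that by (intro sum.cong) auto
    then show ?thesis using that by simp
  qed
  have WS: "W (Suc k) j = (\<Sum>l<n. W k l * Q $$ (l, j))" if "j < n" for k j
  proof -
    have "W (Suc k) j = (\<Sum>i<n. \<Sum>l<n. (Q ^\<^sub>m k) $$ (i, l) * Q $$ (l, j))"
      unfolding W_def using Q Qk[of k] that
      by (intro sum.cong) (auto simp: scalar_prod_def lessThan_atLeast0)
    also have "\<dots> = (\<Sum>l<n. W k l * Q $$ (l, j))"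
      unfolding W_def by (subst sum.swap) (simp add: sum_distrib_right)
    finally show ?thesis .
  qed
  have Wb: "W k j \<le> real n * c" if "j < n" for k j
  proof -
    have "(Q ^\<^sub>m k) $$ (i, j) \<le> c" if "i < n" for i
    proof -
      have "norm ((Q ^\<^sub>m k) $$ (i, j)) \<le> c"
        using c[of k, unfolded norm_bound_def] Qk[of k] that \<open>j < n\<close> by (metis carrier_matD)
      then show ?thesis by simp
    qed
    then have "W k j \<le> (\<Sum>i<n. c)" unfolding W_def by (intro sum_mono) simp
    then show ?thesis by simp
  qed
  have Wpos: "0 \<le> W k j" if "j < n" for k j
    using that
  proof (induction k arbitrary: j)
    case 0 then show ?case by (simp add: W0)
  next
    case (Suc k)
    have "0 \<le> Q $$ (l, j)" if "l < n" for l
      using P that Suc.prems B(1) unfolding Q_def by simp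
    then show ?case unfolding WS[OF Suc.prems] using Suc.IH by (intro sum_nonneg) simp
  qed
  have "(\<lambda>k. \<theta> ^ k * (real n * c)) \<longlonglongrightarrow> 0 * (real n * c)"
    using \<theta> by (intro tendsto_mult LIMSEQ_power_zero tendsto_const) auto
  then have "eventually (\<lambda>k. \<theta> ^ k * (real n * c) < 1) sequentially"
    by (intro order_tendstoD(2)) auto
  then obtain K0 where K0: "\<And>k. k \<ge> K0 \<Longrightarrow> \<theta> ^ k * (real n * c) < 1"
    unfolding eventually_sequentially by blast
  define K where "K = Suc K0"
  define v where "v j = (\<Sum>k<K. \<theta> ^ k * W k j)" for j
  have "0 < v j" if "j < n" for j
  proof -
    have "v j = W 0 j + (\<Sum>k<K0. \<theta> ^ Suc k * W (Suc k) j)"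
      unfolding v_def K_def by (subst sum.lessThan_Suc_shift) simp
    moreover have "0 \<le> (\<Sum>k<K0. \<theta> ^ Suc k * W (Suc k) j)"
      using Wpos[OF that] \<theta> by (intro sum_nonneg) simp
    ultimately show ?thesis using W0[OF that] by simp
  qed
  moreover have "0 \<le> (\<Sum>i<n. v i * X $$ (i, j)) + \<epsilon> * v j" if j: "j < n" for j
  proof -
    have "(\<Sum>i<n. v i * X $$ (i, j)) = (\<Sum>i<n. v i * (if i = j then \<alpha> else 0)) - (\<Sum>i<n. v i * P $$ (i, j))"
      using X j by (simp add: right_diff_distrib sum_subtractf)
    also have "(\<Sum>i<n. v i * (if i = j then \<alpha> else 0)) = v j * \<alpha>"
      using j by (simp add: if_distrib sum.delta cong: if_cong)
    finally have 1: "(\<Sum>i<n. v i * X $$ (i, j)) + \<epsilon> * v j = \<beta> * v j - (\<Sum>i<n. v i * P $$ (i, j))"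
      unfolding \<beta>_def by (simp add: algebra_simps)
    have "(\<Sum>i<n. v i * P $$ (i, j)) = \<gamma> * (\<Sum>i<n. \<Sum>k<K. \<theta> ^ k * W k i * Q $$ (i, j))"
      unfolding v_def using QP j by (simp add: sum_distrib_left sum_distrib_right algebra_simps)
    also have "(\<Sum>i<n. \<Sum>k<K. \<theta> ^ k * W k i * Q $$ (i, j)) = (\<Sum>k<K. \<theta> ^ k * W (Suc k) j)"
      unfolding WS[OF j] by (subst sum.swap) (simp add: sum_distrib_left algebra_simps)
    also have "\<gamma> * (\<Sum>k<K. \<theta> ^ k * W (Suc k) j) = \<beta> * (\<Sum>k<K. \<theta> ^ Suc k * W (Suc k) j)"
      using \<beta> unfolding sum_distrib_left by (intro sum.cong) (auto simp: \<theta>_def)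
    finally have "\<beta> * v j - (\<Sum>i<n. v i * P $$ (i, j))
        = \<beta> * ((\<Sum>k<K. \<theta> ^ k * W k j) - (\<Sum>k<K. \<theta> ^ Suc k * W (Suc k) j))"
      unfolding v_def by (simp add: algebra_simps)
    also have "(\<Sum>k<K. \<theta> ^ k * W k j) - (\<Sum>k<K. \<theta> ^ Suc k * W (Suc k) j) = 1 - \<theta> ^ K * W K j"
      using sum_lessThan_telescope'[of "\<lambda>k. \<theta> ^ k * W k j" K] W0[OF j]
      by (simp add: sum_subtractf)
    finally have 2: "(\<Sum>i<n. v i * X $$ (i, j)) + \<epsilon> * v j = \<beta> * (1 - \<theta> ^ K * W K j)" using 1 by simp
    have "\<theta> ^ K * W K j \<le> \<theta> ^ K * (real n * c)" using Wb[OF j] \<theta> by (intro mult_left_mono) auto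
    also have "\<dots> < 1" by (rule K0) (simp add: K_def)
    finally show ?thesis using 2 \<beta> by simp
  qed
  ultimately show ?thesis by blast
qed simp

lemma M_matrix_diag_nonneg:
  assumes M: "M_matrix n X" and i: "i < n"
  shows "0 \<le> X $$ (i, i)"
proof (rule ccontr)
  assume neg: "\<not> 0 \<le> X $$ (i, i)"
  define \<epsilon> where "\<epsilon> = - X $$ (i, i) / 2"
  have \<epsilon>: "0 < \<epsilon>" using neg unfolding \<epsilon>_def by simp
  from M_matrix_left_vector[OF M this] obtain v where v: "\<forall>k<n. 0 < v k"
    "0 \<le> (\<Sum>k<n. v k * X $$ (k, i)) + \<epsilon> * v i" using i by blast
  have "(\<Sum>k<n. v k * X $$ (k, i)) = v i * X $$ (i, i) + (\<Sum>k\<in>{..<n} - {i}. v k * X $$ (k, i))"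
    using i by (simp add: sum.remove)
  moreover have "(\<Sum>k\<in>{..<n} - {i}. v k * X $$ (k, i)) \<le> 0"
    using v(1) M_matrix_offdiag[OF M] i by (intro sum_nonpos mult_nonneg_nonpos) (auto simp: less_imp_le)
  ultimately have "0 \<le> v i * (X $$ (i, i) + \<epsilon>)" using v(2) by (simp add: algebra_simps)
  moreover have "X $$ (i, i) + \<epsilon> < 0" using neg unfolding \<epsilon>_def by simp
  ultimately show False using v(1) i by (simp add: zero_le_mult_iff) (metis not_le)
qed

text \<open>
  A Harnack inequality: along the paths of the graph, the left vectors above have entries whose
  ratio is bounded independently of \<open>\<epsilon>\<close>. It replaces the passage to a limit \<open>\<epsilon> \<rightarrow> 0\<close> of normalized
  left vectors.
\<close>
lemma M_matrix_harnack:
  assumes M: "M_matrix n X" and acc: "has_access X i k"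
  shows "\<exists>C\<ge>0. \<forall>\<epsilon> v. 0 < \<epsilon> \<longrightarrow> \<epsilon> \<le> 1 \<longrightarrow> (\<forall>l<n. 0 < v l) \<longrightarrow>
    (\<forall>j<n. 0 \<le> (\<Sum>l<n. v l * X $$ (l, j)) + \<epsilon> * v j) \<longrightarrow> v i \<le> C * v k"
  using acc unfolding has_access_def
proof (induction rule: rtrancl_induct)
  case base
  then show ?case by (intro exI[of _ 1]) simp
next
  case (step j k)
  then obtain C where C: "C \<ge> 0" "\<And>\<epsilon> v. 0 < \<epsilon> \<Longrightarrow> \<epsilon> \<le> 1 \<Longrightarrow> (\<forall>l<n. 0 < v l) \<Longrightarrow>
    (\<forall>j<n. 0 \<le> (\<Sum>l<n. v l * X $$ (l, j)) + \<epsilon> * v j) \<Longrightarrow> v i \<le> C * v j" by blast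
  have jk: "j < n" "k < n" "X $$ (j, k) \<noteq> 0"
    using step(2) M_matrix_carrier[OF M] unfolding mat_graph_def by auto
  show ?case
  proof (cases "j = k")
    case True then show ?thesis using C by blast
  next
    case False
    then have neg: "X $$ (j, k) < 0" using M_matrix_offdiag[OF M] jk by force
    \<comment> \<open>The constant comes from column \<open>k\<close>, where \<open>v j * \<bar>X $$ (j, k)\<bar> \<le> (X $$ (k, k) + \<epsilon>) * v k\<close>.\<close>
    define D where "D = (X $$ (k, k) + 1) / - X $$ (j, k)"
    have D: "D \<ge> 0" unfolding D_def using neg M_matrix_diag_nonneg[OF M jk(2)]
      by (intro divide_nonneg_pos) auto
    have "v i \<le> C * D * v k" if v: "0 < \<epsilon>" "\<epsilon> \<le> 1" "\<forall>l<n. 0 < v l"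
      "\<forall>j<n. 0 \<le> (\<Sum>l<n. v l * X $$ (l, j)) + \<epsilon> * v j" for \<epsilon> v
    proof -
      have "(\<Sum>l<n. v l * X $$ (l, k)) = v k * X $$ (k, k) + (v j * X $$ (j, k) + (\<Sum>l\<in>{..<n} - {k} - {j}. v l * X $$ (l, k)))"
        using jk False by (simp add: sum.remove[of _ k] sum.remove[of _ j])
      moreover have "(\<Sum>l\<in>{..<n} - {k} - {j}. v l * X $$ (l, k)) \<le> 0"
        using v(3) M_matrix_offdiag[OF M] jk by (intro sum_nonpos mult_nonneg_nonpos) (auto simp: less_imp_le)
      moreover have "0 \<le> (\<Sum>l<n. v l * X $$ (l, k)) + \<epsilon> * v k" using v(4) jk by blast
      moreover have "\<epsilon> * v k \<le> 1 * v k" using v jk by (intro mult_right_mono) (auto simp: less_imp_le)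
      ultimately have "v j * - X $$ (j, k) \<le> (X $$ (k, k) + 1) * v k" by (simp add: algebra_simps)
      then have "v j \<le> D * v k" unfolding D_def using neg by (simp add: field_simps)
      then have "C * v j \<le> C * (D * v k)" using C(1) by (rule mult_left_mono)
      then show ?thesis using C(2)[OF v] by (simp add: mult.assoc)
    qed
    then show ?thesis using C(1) D by (intro exI[of _ "C * D"]) auto
  qed
qed

section \<open>Access, classes and singular principal submatrices\<close>
lemma det_submatrix_eq_0_iff:
  fixes X :: "real mat"
  assumes X: "X \<in> carrier_mat n n" and J: "J \<subseteq> {..<n}"
  shows "det (submatrix X J J) = 0 \<longleftrightarrow>
    (\<exists>y. (\<exists>j\<in>J. y j \<noteq> 0) \<and> (\<forall>i\<in>J. (\<Sum>j\<in>J. X $$ (i, j) * y j) = 0))"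
proof -
  let ?m = "card J"
  have fin: "finite J" using J finite_subset by blast
  have JX: "{i. i < dim_row X \<and> i \<in> J} = J" "{i. i < dim_col X \<and> i \<in> J} = J" using X J by auto
  have bij: "bij_betw (pick J) {..<?m} J"
  proof (rule bij_betw_imageI)
    have "pick J ` {..<?m} \<subseteq> J" using pick_in_set_le by auto
    moreover have "x \<in> pick J ` {..<?m}" if x: "x \<in> J" for x
    proof -
      have "card {a \<in> J. a < x} < card J" using fin x by (intro psubset_card_mono) auto
      then show ?thesis
        by (intro image_eqI[of _ _ "card {a \<in> J. a < x}"]) (simp_all add: pick_card_in_set[OF x])
    qed
    ultimately show im: "pick J ` {..<?m} = J" by blast
    then show "inj_on (pick J) {..<?m}" by (intro eq_card_imp_inj_on) auto
  qed
  let ?B = "submatrix X J J"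
  have B: "?B \<in> carrier_mat ?m ?m" using dim_submatrix[of X J J] JX by auto
  have entry: "?B $$ (a, b) = X $$ (pick J a, pick J b)" if "a < ?m" "b < ?m" for a b
    using that JX by (intro submatrix_index) simp_all
  have mv: "(?B *\<^sub>v v) $ a = (\<Sum>b<?m. X $$ (pick J a, pick J b) * v $ b)"
    if "a < ?m" "v \<in> carrier_vec ?m" for a v
    using that B entry by (auto simp: scalar_prod_def lessThan_atLeast0 intro!: sum.cong)
  show ?thesis
  proof
    assume "det ?B = 0"
    then obtain v where v: "v \<in> carrier_vec ?m" "v \<noteq> 0\<^sub>v ?m" "?B *\<^sub>v v = 0\<^sub>v ?m"
      using det_0_iff_vec_prod_zero_field[OF B] by blast
    define y where "y j = v $ (the_inv_into {..<?m} (pick J) j)" for j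
    have y: "y (pick J b) = v $ b" if "b < ?m" for b
      unfolding y_def using that bij the_inv_into_f_f[of "pick J" "{..<?m}" b]
      by (auto simp: bij_betw_def)
    have "\<exists>b<?m. v $ b \<noteq> 0"
    proof (rule ccontr)
      assume "\<not> ?thesis"
      then have "v = 0\<^sub>v ?m" using v(1) by (intro eq_vecI) auto
      then show False using v(2) by simp
    qed
    then have "\<exists>j\<in>J. y j \<noteq> 0" using y bij by (metis bij_betwE lessThan_iff)
    moreover have "(\<Sum>j\<in>J. X $$ (i, j) * y j) = 0" if i: "i \<in> J" for i
    proof -
      obtain a where a: "a < ?m" "i = pick J a" using bij i by (auto simp: bij_betw_def)
      have "(\<Sum>j\<in>J. X $$ (i, j) * y j) = (\<Sum>b<?m. X $$ (i, pick J b) * y (pick J b))"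
        by (rule sum.reindex_bij_betw[OF bij, symmetric])
      also have "\<dots> = (?B *\<^sub>v v) $ a" using mv[OF a(1) v(1)] y a(2) by simp
      finally show ?thesis using v(3) a(1) by simp
    qed
    ultimately show "\<exists>y. (\<exists>j\<in>J. y j \<noteq> 0) \<and> (\<forall>i\<in>J. (\<Sum>j\<in>J. X $$ (i, j) * y j) = 0)" by blast
  next
    assume "\<exists>y. (\<exists>j\<in>J. y j \<noteq> 0) \<and> (\<forall>i\<in>J. (\<Sum>j\<in>J. X $$ (i, j) * y j) = 0)"
    then obtain y j where y: "j \<in> J" "y j \<noteq> 0" "\<And>i. i \<in> J \<Longrightarrow> (\<Sum>j\<in>J. X $$ (i, j) * y j) = 0" by blast
    define v where "v = vec ?m (\<lambda>b. y (pick J b))"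
    have v: "v \<in> carrier_vec ?m" unfolding v_def by simp
    obtain b where b: "b < ?m" "j = pick J b" using bij y(1) by (auto simp: bij_betw_def)
    have "v \<noteq> 0\<^sub>v ?m"
    proof
      assume "v = 0\<^sub>v ?m"
      then have "v $ b = 0" using b by simp
      then show False using b y(2) unfolding v_def by simp
    qed
    moreover have "?B *\<^sub>v v = 0\<^sub>v ?m"
    proof (rule eq_vecI)
      show "dim_vec (?B *\<^sub>v v) = dim_vec (0\<^sub>v ?m)" using B by simp
      fix a assume "a < dim_vec (0\<^sub>v ?m :: real vec)"
      then have a: "a < ?m" by simp
      then have aJ: "pick J a \<in> J" using pick_in_set_le by auto
      have "(?B *\<^sub>v v) $ a = (\<Sum>b<?m. X $$ (pick J a, pick J b) * y (pick J b))"
        unfolding mv[OF a v] by (simp add: v_def)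
      also have "\<dots> = (\<Sum>j\<in>J. X $$ (pick J a, j) * y j)" by (rule sum.reindex_bij_betw[OF bij])
      finally show "(?B *\<^sub>v v) $ a = 0\<^sub>v ?m $ a" using y(3)[OF aJ] a by simp
    qed
    ultimately show "det ?B = 0" using det_0_iff_vec_prod_zero_field[OF B] v by blast
  qed
qed

lemma has_access_trans: "has_access X i j \<Longrightarrow> has_access X j k \<Longrightarrow> has_access X i k"
  unfolding has_access_def by (rule rtrancl_trans)

lemma has_access_refl: "has_access X i i"
  unfolding has_access_def by simp

lemma has_access_edge:
  "X \<in> carrier_mat n n \<Longrightarrow> i < n \<Longrightarrow> j < n \<Longrightarrow> X $$ (i, j) \<noteq> 0 \<Longrightarrow> has_access X i j"
  unfolding has_access_def mat_graph_def by auto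

lemma access_classes_iff:
  assumes "X \<in> carrier_mat n n"
  shows "R \<in> access_classes X \<longleftrightarrow>
    (\<exists>i<n. R = {k. k < n \<and> has_access X i k \<and> has_access X k i})"
proof -
  have "{(j, k). j < n \<and> k < n \<and> has_access X j k \<and> has_access X k j} `` {i}
      = {k. k < n \<and> has_access X i k \<and> has_access X k i}" if "i < n" for i
    using that by auto
  then show ?thesis using assms unfolding access_classes_def quotient_def by auto
qed

lemma access_class_props:
  assumes X: "X \<in> carrier_mat n n" and R: "R \<in> access_classes X"
  shows "R \<noteq> {}" "R \<subseteq> {..<n}" "finite R" "i \<in> R \<Longrightarrow> k \<in> R \<Longrightarrow> has_access X i k"
    "i \<in> R \<Longrightarrow> k \<in> R \<Longrightarrow> j < n \<Longrightarrow> has_access X i j \<Longrightarrow> has_access X j k \<Longrightarrow> j \<in> R"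
proof -
  obtain r where r: "r < n" "R = {k. k < n \<and> has_access X r k \<and> has_access X k r}"
    using R access_classes_iff[OF X] by blast
  show "R \<noteq> {}" using r has_access_refl by blast
  show sub: "R \<subseteq> {..<n}" using r by auto
  show "finite R" using sub finite_subset by blast
  show "i \<in> R \<Longrightarrow> k \<in> R \<Longrightarrow> has_access X i k" using r has_access_trans by blast
  show "i \<in> R \<Longrightarrow> k \<in> R \<Longrightarrow> j < n \<Longrightarrow> has_access X i j \<Longrightarrow> has_access X j k \<Longrightarrow> j \<in> R"
    using r has_access_trans by blast
qed

section \<open>Subsolutions on a class\<close>

text \<open>
  Let \<open>Y\<close> be the principal submatrix of \<open>X + diag d\<close> on a class \<open>R\<close>. A nonnegative nonzero \<open>z\<close> with
  \<open>Y z \<le> 0\<close> is a positive null vector of \<open>X\<close> on \<open>R\<close>, and \<open>d\<close> vanishes on \<open>R\<close>. Pairing with the left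
  vectors of \<open>X + \<epsilon>I\<close> and letting \<open>\<epsilon>\<close> tend to \<open>0\<close> gives the equation; positivity holds because the
  zeros of a nonnegative null vector propagate along the edges inside \<open>R\<close>.
\<close>
lemma class_subsolution_is_null_vector:
  assumes M: "M_matrix n X" and R: "R \<in> access_classes X"
    and z: "\<And>i. i \<in> R \<Longrightarrow> 0 \<le> z i" and d: "\<And>i. i \<in> R \<Longrightarrow> 0 \<le> d i"
    and nz: "\<exists>i\<in>R. z i \<noteq> 0"
    and sub: "\<And>i. i \<in> R \<Longrightarrow> (\<Sum>j\<in>R. X $$ (i, j) * z j) + d i * z i \<le> 0"
    and i: "i \<in> R"
  shows "(\<Sum>j\<in>R. X $$ (i, j) * z j) = 0" "0 < z i" "d i = 0"
proof -
  note X = M_matrix_carrier[OF M]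
  note cl = access_class_props[OF X R]
  define g where "g i = (\<Sum>j\<in>R. X $$ (i, j) * z j)" for i
  have g_le: "g i \<le> 0" if "i \<in> R" for i
    using sub[OF that] z[OF that] d[OF that] mult_nonneg_nonneg[of "d i" "z i"] unfolding g_def by linarith
  have g0: "g i = 0" if i: "i \<in> R" for i
  proof (rule ccontr)
    assume "g i \<noteq> 0"
    then have neg: "g i < 0" using g_le[OF i] by simp
    have "\<forall>k\<in>R. \<exists>C\<ge>0. \<forall>\<epsilon> v. 0 < \<epsilon> \<longrightarrow> \<epsilon> \<le> 1 \<longrightarrow> (\<forall>l<n. 0 < v l) \<longrightarrow>
      (\<forall>j<n. 0 \<le> (\<Sum>l<n. v l * X $$ (l, j)) + \<epsilon> * v j) \<longrightarrow> v k \<le> C * v i"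
      using M_matrix_harnack[OF M] cl(4) i by blast
    then obtain C where C: "\<And>k. k \<in> R \<Longrightarrow> 0 \<le> C k"
      "\<And>k \<epsilon> v. k \<in> R \<Longrightarrow> 0 < \<epsilon> \<Longrightarrow> \<epsilon> \<le> 1 \<Longrightarrow> (\<forall>l<n. 0 < v l) \<Longrightarrow>
      (\<forall>j<n. 0 \<le> (\<Sum>l<n. v l * X $$ (l, j)) + \<epsilon> * v j) \<Longrightarrow> v k \<le> C k * v i"
      unfolding bchoice_iff by blast
    define B where "B = (\<Sum>k\<in>R. C k * z k)"
    have B: "0 \<le> B" unfolding B_def using C(1) z by (intro sum_nonneg) simp
    \<comment> \<open>Small enough for the error term \<open>\<epsilon> * B\<close> not to compensate \<open>g i < 0\<close>.\<close>
    define \<epsilon> where "\<epsilon> = min 1 (- g i / (2 * (B + 1)))"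
    have \<epsilon>: "0 < \<epsilon>" "\<epsilon> \<le> 1" using neg B unfolding \<epsilon>_def by (auto simp: divide_neg_pos)
    have "\<epsilon> * B \<le> (- g i / (2 * (B + 1))) * (B + 1)"
      using B neg \<epsilon> unfolding \<epsilon>_def by (intro mult_mono) auto
    also have "\<dots> = - g i / 2" using B by (simp add: field_simps)
    finally have \<epsilon>B: "g i + \<epsilon> * B < 0" using neg by simp
    obtain v where v: "\<forall>l<n. 0 < v l" "\<forall>j<n. 0 \<le> (\<Sum>l<n. v l * X $$ (l, j)) + \<epsilon> * v j"
      using M_matrix_left_vector[OF M \<epsilon>(1)] by blast
    have vR: "0 < v l" if "l \<in> R" for l using v(1) cl(2) that by auto
    have "0 \<le> (\<Sum>j\<in>R. ((\<Sum>l\<in>R. v l * X $$ (l, j)) + \<epsilon> * v j) * z j)"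
    proof (intro sum_nonneg mult_nonneg_nonneg z)
      fix j assume j: "j \<in> R"
      have "(\<Sum>l<n. v l * X $$ (l, j)) = (\<Sum>l\<in>{..<n} - R. v l * X $$ (l, j)) + (\<Sum>l\<in>R. v l * X $$ (l, j))"
        using cl(2) by (intro sum.subset_diff) auto
      moreover have "(\<Sum>l\<in>{..<n} - R. v l * X $$ (l, j)) \<le> 0"
      proof (intro sum_nonpos mult_nonneg_nonpos)
        fix l assume "l \<in> {..<n} - R"
        then show "0 \<le> v l" "X $$ (l, j) \<le> 0"
          using v(1) M_matrix_offdiag[OF M, of l j] j cl(2) by (auto simp: less_imp_le)
      qed
      moreover have "0 \<le> (\<Sum>l<n. v l * X $$ (l, j)) + \<epsilon> * v j" using v(2) j cl(2) by auto
      ultimately show "0 \<le> (\<Sum>l\<in>R. v l * X $$ (l, j)) + \<epsilon> * v j" by linarith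
    qed
    also have "\<dots> = (\<Sum>j\<in>R. \<Sum>l\<in>R. v l * X $$ (l, j) * z j) + \<epsilon> * (\<Sum>j\<in>R. v j * z j)"
      by (simp add: distrib_right sum.distrib sum_distrib_left sum_distrib_right mult.assoc)
    also have "(\<Sum>j\<in>R. \<Sum>l\<in>R. v l * X $$ (l, j) * z j) = (\<Sum>l\<in>R. v l * g l)"
      unfolding g_def by (subst sum.swap) (simp add: sum_distrib_left mult.assoc)
    also have "(\<Sum>l\<in>R. v l * g l) \<le> v i * g i"
    proof -
      have "(\<Sum>l\<in>R - {i}. v l * g l) \<le> 0"
        using vR g_le by (intro sum_nonpos mult_nonneg_nonpos) (auto simp: less_imp_le)
      then show ?thesis using i cl(3) by (simp add: sum.remove[of R i])
    qed
    also have "\<epsilon> * (\<Sum>j\<in>R. v j * z j) \<le> \<epsilon> * (\<Sum>j\<in>R. (C j * v i) * z j)"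
      using C(2)[OF _ \<epsilon> v] z \<epsilon> by (intro mult_left_mono sum_mono mult_right_mono) auto
    also have "(\<Sum>j\<in>R. (C j * v i) * z j) = v i * B"
      unfolding B_def by (simp add: sum_distrib_left algebra_simps)
    also have "v i * g i + \<epsilon> * (v i * B) = v i * (g i + \<epsilon> * B)" by (simp add: algebra_simps)
    finally show False using \<epsilon>B vR[OF i] by (simp add: zero_le_mult_iff)
  qed
  then show "(\<Sum>j\<in>R. X $$ (i, j) * z j) = 0" using i unfolding g_def by blast
  show zi: "0 < z i"
  proof (rule ccontr)
    assume "\<not> 0 < z i"
    then have z0: "z i = 0" using z[OF i] by simp
    have "k \<in> R \<Longrightarrow> z k = 0" if "(i, k) \<in> (mat_graph X)\<^sup>*" for k
      using that
    proof (induction rule: rtrancl_induct)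
      case base show ?case by (fact z0)
    next
      case (step j k)
      have jk: "j < n" "X $$ (j, k) \<noteq> 0" using step(2) X unfolding mat_graph_def by auto
      have "j \<in> R"
        using cl(5)[OF i \<open>k \<in> R\<close> jk(1)] step(1,2) unfolding has_access_def by auto
      then have zj: "z j = 0" and "(\<Sum>l\<in>R. X $$ (j, l) * z l) = 0"
        using step.IH g0[of j] unfolding g_def by auto
      have "(\<Sum>l\<in>R. - (X $$ (j, l) * z l)) = 0" using \<open>(\<Sum>l\<in>R. X $$ (j, l) * z l) = 0\<close> by (simp add: sum_negf)
      moreover have "0 \<le> - (X $$ (j, l) * z l)" if "l \<in> R" for l
        using M_matrix_offdiag[OF M, of j l] zj z[OF that] that cl(2) jk(1)
        by (cases "l = j") (auto intro!: mult_nonpos_nonneg)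
      ultimately have "- (X $$ (j, k) * z k) = 0"
        using sum_nonneg_0[OF cl(3), of "\<lambda>l. - (X $$ (j, l) * z l)" k] \<open>k \<in> R\<close> by simp
      then show ?case using jk by auto
    qed
    then show False using nz cl(4)[OF i] unfolding has_access_def by blast
  qed
  show "d i = 0"
    using sub[OF i] g0[OF i] zi d[OF i] unfolding g_def by (simp add: mult_le_0_iff)
qed

lemma sum_abs_null_le_0:
  assumes R: "finite R" "i \<in> R" and diag: "0 \<le> (x i :: real)"
    and off: "\<And>j. j \<in> R \<Longrightarrow> j \<noteq> i \<Longrightarrow> x j \<le> 0" and null: "(\<Sum>j\<in>R. x j * y j) = 0"
  shows "(\<Sum>j\<in>R. x j * \<bar>y j\<bar>) \<le> 0"
proof -
  have "x i * \<bar>y i\<bar> = \<bar>x i * y i\<bar>" using diag by (simp add: abs_mult)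
  also have "x i * y i = - (\<Sum>j\<in>R - {i}. x j * y j)" using null R by (simp add: sum.remove)
  also have "\<bar>- (\<Sum>j\<in>R - {i}. x j * y j)\<bar> \<le> (\<Sum>j\<in>R - {i}. \<bar>x j * y j\<bar>)" by (simp add: sum_abs)
  also have "\<dots> = (\<Sum>j\<in>R - {i}. - (x j * \<bar>y j\<bar>))" using off by (intro sum.cong) (auto simp: abs_mult)
  finally show ?thesis using R by (simp add: sum.remove sum_negf)
qed

lemma singular_class_null_vector:
  assumes M: "M_matrix n X" and Q: "Q \<in> singular_classes X"
  obtains z where "\<And>i. i \<in> Q \<Longrightarrow> 0 < z i" "\<And>i. i \<notin> Q \<Longrightarrow> z i = 0"
    "\<And>i. i \<in> Q \<Longrightarrow> (\<Sum>j\<in>Q. X $$ (i, j) * z j) = 0"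
proof -
  note X = M_matrix_carrier[OF M]
  have Qc: "Q \<in> access_classes X" and det: "det (submatrix X Q Q) = 0"
    using Q unfolding singular_classes_def by auto
  note cl = access_class_props[OF X Qc]
  obtain y where y: "\<exists>j\<in>Q. y j \<noteq> 0" "\<forall>i\<in>Q. (\<Sum>j\<in>Q. X $$ (i, j) * y j) = 0"
    using det det_submatrix_eq_0_iff[OF X cl(2)] by blast
  define z where "z i = (if i \<in> Q then \<bar>y i\<bar> else 0)" for i
  have "(\<Sum>j\<in>Q. X $$ (i, j) * z j) + 0 * z i \<le> 0" if i: "i \<in> Q" for i
  proof -
    have "(\<Sum>j\<in>Q. X $$ (i, j) * \<bar>y j\<bar>) \<le> 0"
      using M_matrix_diag_nonneg[OF M] M_matrix_offdiag[OF M] cl(2,3) i y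
      by (intro sum_abs_null_le_0) auto
    then show ?thesis unfolding z_def by (simp cong: sum.cong)
  qed
  note null = class_subsolution_is_null_vector(1,2)[OF M Qc, of z "\<lambda>_. 0", OF _ _ _ this]
  have "0 \<le> z i" "\<exists>i\<in>Q. z i \<noteq> 0" for i using y(1) unfolding z_def by auto
  then show thesis using null by (intro that[of z]) (auto simp: z_def)
qed

section \<open>Monotonicity of diagonal perturbations\<close>

text \<open>
  For \<open>d \<ge> 0\<close>, the matrix \<open>X + diag d\<close> is monotone (it maps only nonnegative vectors to nonnegative
  ones) unless \<open>d\<close> vanishes on some singular class of \<open>X\<close>. The negative part \<open>z\<close> of a counterexample
  \<open>u\<close> is a subsolution; it remains one when restricted to a class that is final among the classes
  meeting its support.
\<close>
lemma monotone_if_no_singular_class: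
  assumes M: "M_matrix n X" and d: "\<And>i. i < n \<Longrightarrow> 0 \<le> d i"
    and ns: "\<not> (\<exists>R\<in>singular_classes X. \<forall>i\<in>R. d i = 0)"
    and u: "\<And>i. i < n \<Longrightarrow> 0 \<le> (\<Sum>j<n. X $$ (i, j) * u j) + d i * u i" and i: "i < n"
  shows "0 \<le> u i"
proof (rule ccontr)
  assume "\<not> 0 \<le> u i"
  note X = M_matrix_carrier[OF M]
  define z where "z k = max 0 (- u k)" for k
  have z: "0 \<le> z k" for k unfolding z_def by simp
  have sub: "(\<Sum>j<n. X $$ (k, j) * z j) + d k * z k \<le> 0" if k: "k < n" for k
  proof (cases "u k < 0")
    case True
    have "(\<Sum>j<n. X $$ (k, j) * (z j + u j)) \<le> 0"
    proof (intro sum_nonpos)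
      fix j assume "j \<in> {..<n}"
      then show "X $$ (k, j) * (z j + u j) \<le> 0"
        using M_matrix_offdiag[OF M k, of j] True unfolding z_def
        by (cases "j = k") (auto intro!: mult_nonpos_nonneg)
    qed
    moreover have "z k = - u k" using True unfolding z_def by simp
    ultimately show ?thesis using u[OF k] by (simp add: distrib_left sum.distrib)
  next
    case False
    then have zk: "z k = 0" unfolding z_def by simp
    have "(\<Sum>j<n. X $$ (k, j) * z j) \<le> 0"
    proof (intro sum_nonpos)
      fix j assume "j \<in> {..<n}"
      then show "X $$ (k, j) * z j \<le> 0"
        using M_matrix_offdiag[OF M k, of j] zk z[of j]
        by (cases "j = k") (auto intro!: mult_nonpos_nonneg)
    qed
    then show ?thesis using zk by simp
  qed
  \<comment> \<open>A vertex of the support of \<open>z\<close> with the fewest vertices accessed lies in such a final class.\<close>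
  define acc where "acc k = {j. j < n \<and> has_access X k j}" for k
  have "i < n \<and> z i \<noteq> 0" using i \<open>\<not> 0 \<le> u i\<close> unfolding z_def by simp
  then obtain r where r: "r < n" "z r \<noteq> 0"
    and least: "\<And>k. k < n \<Longrightarrow> z k \<noteq> 0 \<Longrightarrow> card (acc r) \<le> card (acc k)"
    using ex_has_least_nat[of "\<lambda>k. k < n \<and> z k \<noteq> 0" i "\<lambda>k. card (acc k)"] by blast
  define R where "R = {k. k < n \<and> has_access X r k \<and> has_access X k r}"
  have R: "R \<in> access_classes X" unfolding access_classes_iff[OF X] R_def using r by blast
  note cl = access_class_props[OF X R]
  have out: "z j = 0" if k: "k \<in> R" and j: "j < n" "j \<notin> R" "X $$ (k, j) \<noteq> 0" for k j
  proof (rule ccontr)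
    assume "z j \<noteq> 0"
    have kj: "has_access X k j" using has_access_edge[OF X _ j(1,3)] k cl(2) by auto
    then have rj: "has_access X r j" using k has_access_trans unfolding R_def by blast
    then have "\<not> has_access X j r" using j unfolding R_def by blast
    then have "acc j \<subset> acc r" using rj r(1) has_access_trans has_access_refl unfolding acc_def by blast
    then have "card (acc j) < card (acc r)" by (intro psubset_card_mono) (auto simp: acc_def)
    then show False using least[OF j(1) \<open>z j \<noteq> 0\<close>] by simp
  qed
  have restrict: "(\<Sum>j<n. X $$ (k, j) * z j) = (\<Sum>j\<in>R. X $$ (k, j) * z j)" if "k \<in> R" for k
    using out[OF that] cl(2) by (intro sum.mono_neutral_right) auto
  have rR: "r \<in> R" using r has_access_refl unfolding R_def by blast
  have Rn: "k < n" if "k \<in> R" for k using that cl(2) by auto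
  have subR: "(\<Sum>j\<in>R. X $$ (k, j) * z j) + d k * z k \<le> 0" if "k \<in> R" for k
    using sub[OF Rn[OF that]] restrict[OF that] by simp
  have nz: "\<exists>k\<in>R. z k \<noteq> 0" using rR r(2) by blast
  have *: "(\<Sum>j\<in>R. X $$ (k, j) * z j) = 0 \<and> d k = 0" if "k \<in> R" for k
    using class_subsolution_is_null_vector(1,3)[OF M R z d[OF Rn] nz subR that] by simp
  then have "det (submatrix X R R) = 0"
    unfolding det_submatrix_eq_0_iff[OF X cl(2)] using rR r(2) by blast
  then show False using ns R * unfolding singular_classes_def by blast
qed

section \<open>A singular class of the product contains one of a factor\<close>
lemma mult_entry:
  assumes "L \<in> carrier_mat n n" "U \<in> carrier_mat n n" "i < n" "j < n"
  shows "(L * U) $$ (i, j) = (\<Sum>k<n. L $$ (i, k) * U $$ (k, j))"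
  using assms by (auto simp: scalar_prod_def lessThan_atLeast0 intro!: sum.cong)

lemma mult_apply:
  fixes L U :: "real mat"
  assumes "L \<in> carrier_mat n n" "U \<in> carrier_mat n n" "i < n"
  shows "(\<Sum>k<n. L $$ (i, k) * (\<Sum>j<n. U $$ (k, j) * y j)) = (\<Sum>j<n. (L * U) $$ (i, j) * y j)"
proof -
  have "(\<Sum>j<n. (L * U) $$ (i, j) * y j) = (\<Sum>j<n. \<Sum>k<n. L $$ (i, k) * U $$ (k, j) * y j)"
    using mult_entry[OF assms(1-3)] by (simp add: sum_distrib_right)
  also have "\<dots> = (\<Sum>k<n. L $$ (i, k) * (\<Sum>j<n. U $$ (k, j) * y j))"
    by (subst sum.swap) (simp add: sum_distrib_left mult.assoc)
  finally show ?thesis by simp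
qed

text \<open>
  Let \<open>D = diag d\<close> be the indicator of the complement of \<open>S\<close>. Without a singular class inside \<open>S\<close>,
  both \<open>L + D\<close> and \<open>U + D\<close> are monotone, hence so is their product. But the product agrees with
  \<open>A\<close> on \<open>S \<times> S\<close> and has nonpositive entries off the diagonal, so it maps \<open>-z\<close> to a nonnegative
  vector, where \<open>z\<close> is a positive null vector of \<open>A\<close> on \<open>S\<close>, extended by \<open>0\<close>.
\<close>
lemma singular_class_of_some_factor:
  assumes hA: "M_matrix n A" and hL: "M_matrix n L" and hU: "M_matrix n U" and A: "A = L * U"
    and S: "S \<in> singular_classes A"
  shows "\<exists>Q. Q \<subseteq> S \<and> (Q \<in> singular_classes L \<or> Q \<in> singular_classes U)"
proof (rule ccontr)
  assume no: "\<not> ?thesis"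
  note cA = M_matrix_carrier[OF hA] and cL = M_matrix_carrier[OF hL] and cU = M_matrix_carrier[OF hU]
  obtain z where z: "\<And>i. i \<in> S \<Longrightarrow> 0 < z i" "\<And>i. i \<notin> S \<Longrightarrow> z i = 0"
    "\<And>i. i \<in> S \<Longrightarrow> (\<Sum>j\<in>S. A $$ (i, j) * z j) = 0"
    by (rule singular_class_null_vector[OF hA S]) blast
  have Sc: "S \<in> access_classes A" using S unfolding singular_classes_def by simp
  note cl = access_class_props[OF cA Sc]
  have z0: "0 \<le> z i" for i using z(1,2)[of i] by (cases "i \<in> S") auto
  define d where "d i = (if i \<in> S then 0 else 1::real)" for i
  have d: "0 \<le> d i" "d i * z i = 0" for i using z(2)[of i] unfolding d_def by auto
  have ns: "\<not> (\<exists>R\<in>singular_classes L. \<forall>i\<in>R. d i = 0)" "\<not> (\<exists>R\<in>singular_classes U. \<forall>i\<in>R. d i = 0)"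
    using no unfolding d_def by (auto split: if_splits)
  \<comment> \<open>\<open>w = (U + D)(-z)\<close>, in which \<open>D\<close> does not contribute because \<open>z\<close> vanishes off \<open>S\<close>.\<close>
  define w where "w k = (\<Sum>j<n. U $$ (k, j) * - z j) + d k * - z k" for k
  have w: "w k = - (\<Sum>j<n. U $$ (k, j) * z j)" for k unfolding w_def using d(2) by (simp add: sum_negf)
  have Lw: "0 \<le> (\<Sum>k<n. L $$ (i, k) * w k) + d i * w i" if i: "i < n" for i
  proof -
    have "(\<Sum>k<n. L $$ (i, k) * w k) = - (\<Sum>j<n. A $$ (i, j) * z j)"
      unfolding w A mult_apply[OF cL cU i, symmetric] by (simp add: sum_negf)
    also have "(\<Sum>j<n. A $$ (i, j) * z j) = (\<Sum>j\<in>S. A $$ (i, j) * z j)"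
      using z(2) cl(2) by (intro sum.mono_neutral_right) auto
    finally have Lw: "(\<Sum>k<n. L $$ (i, k) * w k) = - (\<Sum>j\<in>S. A $$ (i, j) * z j)" .
    show ?thesis
    proof (cases "i \<in> S")
      case True then show ?thesis using Lw z(3) unfolding d_def by simp
    next
      case False
      have "(\<Sum>j\<in>S. A $$ (i, j) * z j) \<le> 0"
      proof (intro sum_nonpos mult_nonpos_nonneg z0)
        fix j assume "j \<in> S"
        then show "A $$ (i, j) \<le> 0" using False cl(2) M_matrix_offdiag[OF hA i, of j] by auto
      qed
      moreover have "(\<Sum>j<n. U $$ (i, j) * z j) \<le> 0"
      proof (intro sum_nonpos)
        fix j assume "j \<in> {..<n}"
        then show "U $$ (i, j) * z j \<le> 0"
          using M_matrix_offdiag[OF hU i, of j] z(2)[OF False] z0[of j]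
          by (cases "j = i") (auto intro!: mult_nonpos_nonneg)
      qed
      ultimately show ?thesis using False Lw w[of i] unfolding d_def by simp
    qed
  qed
  have wn: "0 \<le> (\<Sum>j<n. U $$ (k, j) * - z j) + d k * - z k" if "k < n" for k
    using monotone_if_no_singular_class[OF hL d(1) ns(1) Lw that] unfolding w_def .
  have "0 \<le> - z i" if "i < n" for i
    by (rule monotone_if_no_singular_class[OF hU d(1) ns(2) wn that])
  moreover obtain i where "i \<in> S" "i < n" using cl(1,2) by blast
  ultimately show False using z(1)[of i] by force
qed

section \<open>Access to a singular class of a factor\<close>
lemma shifted_M_matrix_solve:
  assumes M: "M_matrix n X" and r: "\<And>i. i < n \<Longrightarrow> 0 \<le> r i"
  shows "\<exists>y. \<forall>i<n. 0 \<le> y i \<and> (\<Sum>j<n. X $$ (i, j) * y j) + y i = r i"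
proof -
  note X = M_matrix_carrier[OF M]
  have "\<not> (\<exists>R\<in>singular_classes X. \<forall>i\<in>R. (1::real) = 0)"
    using access_class_props(1)[OF X] unfolding singular_classes_def by auto
  note mono = monotone_if_no_singular_class[OF M, of "\<lambda>_. 1", OF _ this, simplified]
  let ?B = "X + 1\<^sub>m n"
  have B: "?B \<in> carrier_mat n n" using X by simp
  have mv: "(?B *\<^sub>v v) $ i = (\<Sum>j<n. X $$ (i, j) * v $ j) + v $ i" if "v \<in> carrier_vec n" "i < n" for v i
  proof -
    have "(?B *\<^sub>v v) $ i = (\<Sum>j<n. X $$ (i, j) * v $ j + (if j = i then v $ j else 0))"
      using that X by (auto simp: scalar_prod_def lessThan_atLeast0 algebra_simps intro!: sum.cong)
    then show ?thesis using that by (simp add: sum.distrib)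
  qed
  have "det ?B \<noteq> 0"
  proof
    assume "det ?B = 0"
    then obtain v where v: "v \<in> carrier_vec n" "v \<noteq> 0\<^sub>v n" "?B *\<^sub>v v = 0\<^sub>v n"
      using det_0_iff_vec_prod_zero_field[OF B] by blast
    have eq: "(\<Sum>j<n. X $$ (i, j) * v $ j) + v $ i = 0" if "i < n" for i
      using mv[OF v(1) that] v(3) that by simp
    have "0 \<le> v $ i" if "i < n" for i
      using mono[of "\<lambda>j. v $ j"] eq that by simp
    moreover have "0 \<le> - v $ i" if "i < n" for i
    proof -
      have "(\<Sum>j<n. X $$ (k, j) * - v $ j) + - v $ k = 0" if "k < n" for k
        using eq[OF that] by (simp add: sum_negf)
      then show ?thesis using mono[of "\<lambda>j. - v $ j"] that by simp
    qed
    ultimately have "v $ i = 0" if "i < n" for i using that by (metis antisym neg_0_le_iff_le)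
    then have "v = 0\<^sub>v n" using v(1) by (intro eq_vecI) auto
    then show False using v(2) by simp
  qed
  then have "?B \<in> Units (ring_mat TYPE(real) n ())"
    by (rule det_non_zero_imp_unit[OF B])
  then obtain B' where B': "B' \<in> carrier_mat n n" "?B * B' = 1\<^sub>m n"
    unfolding Units_def by (auto simp: ring_mat_def)
  define v where "v = B' *\<^sub>v vec n r"
  have v: "v \<in> carrier_vec n" using B' unfolding v_def by simp
  have "?B *\<^sub>v v = vec n r"
    unfolding v_def using assoc_mult_mat_vec[OF B B'(1), of "vec n r"] B'(2) by simp
  then have eq: "(\<Sum>j<n. X $$ (i, j) * v $ j) + v $ i = r i" if "i < n" for i
    using mv[OF v that] that by simp
  moreover have "0 \<le> v $ i" if "i < n" for i
    using mono[of "\<lambda>j. v $ j"] eq r that by simp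
  ultimately show ?thesis by (intro exI[of _ "\<lambda>j. v $ j"]) blast
qed

text \<open>
  Let \<open>D\<close> be the indicator of the complement of a singular class \<open>Q\<close>. Then \<open>X + D\<close> has a nonnegative
  null vector that is positive on \<open>Q\<close> and supported on the vertices with access to \<open>Q\<close>. It is \<open>z + y\<close>,
  with \<open>z\<close> the null vector of the class and \<open>y\<close> the solution of \<open>(X + I) y = - X z\<close>, which
  is supported on the vertices outside \<open>Q\<close> with access to \<open>Q\<close>, where \<open>D\<close> and \<open>I\<close> agree.
\<close>
lemma null_vector_accessing_singular_class:
  assumes M: "M_matrix n X" and Q: "Q \<in> singular_classes X"
  obtains x where "\<And>i. i < n \<Longrightarrow> 0 \<le> x i" "\<And>i. i \<in> Q \<Longrightarrow> 0 < x i"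
    "\<And>i. i < n \<Longrightarrow> x i \<noteq> 0 \<Longrightarrow> \<exists>q\<in>Q. has_access X i q"
    "\<And>i. i < n \<Longrightarrow> (\<Sum>j<n. X $$ (i, j) * x j) + (if i \<in> Q then 0 else x i) = 0"
proof -
  note X = M_matrix_carrier[OF M]
  have Qc: "Q \<in> access_classes X" using Q unfolding singular_classes_def by simp
  note cl = access_class_props[OF X Qc]
  obtain z where z: "\<And>i. i \<in> Q \<Longrightarrow> 0 < z i" "\<And>i. i \<notin> Q \<Longrightarrow> z i = 0"
    "\<And>i. i \<in> Q \<Longrightarrow> (\<Sum>j\<in>Q. X $$ (i, j) * z j) = 0"
    by (rule singular_class_null_vector[OF M Q]) blast
  define K where "K = {i. i < n \<and> (\<exists>q\<in>Q. has_access X i q)}"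
  have QK: "Q \<subseteq> K" using cl(2) has_access_refl unfolding K_def by blast
  define r where "r i = - (\<Sum>j\<in>Q. X $$ (i, j) * z j)" for i
  have Xz: "(\<Sum>j<n. X $$ (i, j) * z j) = - r i" for i
  proof -
    have "(\<Sum>j<n. X $$ (i, j) * z j) = (\<Sum>j\<in>Q. X $$ (i, j) * z j)"
      using z(2) cl(2) by (intro sum.mono_neutral_right) auto
    then show ?thesis unfolding r_def by simp
  qed
  have rQ: "r i = 0" if "i \<in> Q" for i using z(3)[OF that] unfolding r_def by simp
  have edge: "has_access X i j" if "i < n" "j < n" "X $$ (i, j) \<noteq> 0" for i j
    using has_access_edge[OF X that] .
  have rK: "r i = 0" if "i < n" "i \<notin> K" for i
  proof -
    have "X $$ (i, j) = 0" if "j \<in> Q" for j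
      using edge[of i j] that \<open>i < n\<close> \<open>i \<notin> K\<close> cl(2) unfolding K_def by auto
    then show ?thesis unfolding r_def by simp
  qed
  have r0: "0 \<le> r i" if "i < n" for i
  proof (cases "i \<in> Q")
    case False
    have "(\<Sum>j\<in>Q. X $$ (i, j) * z j) \<le> 0"
    proof (intro sum_nonpos mult_nonpos_nonneg)
      fix j assume "j \<in> Q"
      then show "X $$ (i, j) \<le> 0" "0 \<le> z j"
        using False cl(2) M_matrix_offdiag[OF M that, of j] z(1)[of j] by auto
    qed
    then show ?thesis unfolding r_def by simp
  qed (simp add: rQ)
  obtain y where y: "\<And>i. i < n \<Longrightarrow> 0 \<le> y i"
    "\<And>i. i < n \<Longrightarrow> (\<Sum>j<n. X $$ (i, j) * y j) + y i = r i"
    using shifted_M_matrix_solve[of n X r, OF M r0] by blast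
  define N where "N = K - Q"
  have noedge: "X $$ (i, j) = 0" if ij: "i < n" "i \<notin> N" "j \<in> N" for i j
  proof (rule ccontr)
    assume nz: "X $$ (i, j) \<noteq> 0"
    obtain q where q: "q \<in> Q" "has_access X j q" "j < n" "j \<notin> Q" using ij(3) unfolding N_def K_def by blast
    have acc: "has_access X i j" using edge nz ij(1) q(3) by blast
    then have "i \<in> Q" using q ij acc has_access_trans unfolding N_def K_def by blast
    then show False using cl(5)[OF _ q(1) q(3) acc q(2)] q(4) by blast
  qed
  have yN: "y i = 0" if i: "i < n" "i \<notin> N" for i
  proof -
    \<comment> \<open>Minus the part of \<open>y\<close> outside \<open>N\<close>: its image under \<open>X + I\<close> is nonnegative, so monotonicity makes it vanish.\<close>
    define u where "u k = (if k \<in> N then 0 else - y k)" for k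
    have "0 \<le> (\<Sum>j<n. X $$ (k, j) * u j) + 1 * u k" if k: "k < n" for k
    proof (cases "k \<in> N")
      case True
      have "0 \<le> X $$ (k, j) * u j" if "j < n" for j
        using M_matrix_offdiag[OF M k that] y(1)[OF that] True unfolding u_def
        by (cases "j = k") (auto intro!: mult_nonpos_nonneg)
      then have "0 \<le> (\<Sum>j<n. X $$ (k, j) * u j)" by (intro sum_nonneg) simp
      then show ?thesis using True unfolding u_def by simp
    next
      case False
      have "(\<Sum>j<n. X $$ (k, j) * u j) = - (\<Sum>j<n. X $$ (k, j) * y j)"
        unfolding sum_negf[symmetric] using noedge[OF k False] by (intro sum.cong) (auto simp: u_def)
      moreover have "r k = 0" using False rK[OF k] rQ[of k] unfolding N_def by blast
      ultimately show ?thesis using y(2)[OF k] False unfolding u_def by simp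
    qed
    moreover have "\<not> (\<exists>R\<in>singular_classes X. \<forall>i\<in>R. (1::real) = 0)"
      using access_class_props(1)[OF X] unfolding singular_classes_def by auto
    ultimately have "0 \<le> u i" using monotone_if_no_singular_class[OF M, of "\<lambda>_. 1" u i] i by simp
    then show ?thesis using y(1)[OF i(1)] i(2) unfolding u_def by simp
  qed
  show thesis
  proof (rule that[of "\<lambda>i. z i + y i"])
    have zn: "0 \<le> z i" for i using z(1,2)[of i] by (cases "i \<in> Q") auto
    show "0 \<le> z i + y i" if "i < n" for i using zn[of i] y(1)[OF that] by simp
    show "0 < z i + y i" if "i \<in> Q" for i using z(1)[OF that] y(1)[of i] cl(2) that by fastforce
    show "\<exists>q\<in>Q. has_access X i q" if "i < n" "z i + y i \<noteq> 0" for i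
    proof -
      have "i \<in> K" using that yN[of i] z(2)[of i] QK unfolding N_def by fastforce
      then show ?thesis unfolding K_def by blast
    qed
    show "(\<Sum>j<n. X $$ (i, j) * (z j + y j)) + (if i \<in> Q then 0 else z i + y i) = 0" if "i < n" for i
      using Xz[of i] y(2)[OF that] yN[OF that] z(2)[of i]
      by (auto simp: distrib_left sum.distrib N_def)
  qed
qed

text \<open>
  Whatever has access to \<open>Q\<close> in \<open>A\<close> has access to \<open>Q\<close> in \<open>U\<close>. The vector \<open>x\<close> of the preceding lemma
  is a null vector of \<open>L (U + D) = A + L D\<close>. In a row where \<open>x\<close> vanishes all terms are nonpositive,
  hence zero, so the support of \<open>x\<close> is closed under predecessors in the graph of \<open>A\<close>.
\<close>
lemma access_to_singular_class_of_right_factor: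
  assumes hA: "M_matrix n A" and hL: "M_matrix n L" and hU: "M_matrix n U" and A: "A = L * U"
    and Q: "Q \<in> singular_classes U" and q: "q \<in> Q" and acc: "has_access A i q" and i: "i < n"
  shows "\<exists>q\<in>Q. has_access U i q"
proof -
  note cA = M_matrix_carrier[OF hA] and cL = M_matrix_carrier[OF hL] and cU = M_matrix_carrier[OF hU]
  obtain x where x: "\<And>i. i < n \<Longrightarrow> 0 \<le> x i" "\<And>i. i \<in> Q \<Longrightarrow> 0 < x i"
    "\<And>i. i < n \<Longrightarrow> x i \<noteq> 0 \<Longrightarrow> \<exists>q\<in>Q. has_access U i q"
    "\<And>i. i < n \<Longrightarrow> (\<Sum>j<n. U $$ (i, j) * x j) + (if i \<in> Q then 0 else x i) = 0"
    by (rule null_vector_accessing_singular_class[OF hU Q]) blast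
  \<comment> \<open>\<open>e = D x\<close>\<close>
  define e where "e k = (if k \<in> Q then 0 else x k)" for k
  have e: "0 \<le> e k" "x k = 0 \<Longrightarrow> e k = 0" if "k < n" for k using x(1)[OF that] unfolding e_def by auto
  have null: "(\<Sum>j<n. A $$ (k, j) * x j + L $$ (k, j) * e j) = 0" if k: "k < n" for k
  proof -
    have "(\<Sum>j<n. A $$ (k, j) * x j) = (\<Sum>l<n. L $$ (k, l) * (\<Sum>j<n. U $$ (l, j) * x j))"
      unfolding A by (rule mult_apply[OF cL cU k, symmetric])
    also have "\<dots> = (\<Sum>l<n. L $$ (k, l) * - e l)"
    proof (rule sum.cong)
      fix l assume "l \<in> {..<n}"
      then have "(\<Sum>j<n. U $$ (l, j) * x j) = - e l"
        using x(4)[of l] unfolding e_def by (simp add: eq_neg_iff_add_eq_0)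
      then show "L $$ (k, l) * (\<Sum>j<n. U $$ (l, j) * x j) = L $$ (k, l) * - e l" by simp
    qed simp
    finally show ?thesis by (simp add: sum.distrib sum_negf)
  qed
  have pred: "x j \<noteq> 0" if edge: "(j, k) \<in> mat_graph A" and k: "x k \<noteq> 0" for j k
  proof
    assume j0: "x j = 0"
    have jk: "j < n" "k < n" "A $$ (j, k) \<noteq> 0" using edge cA unfolding mat_graph_def by auto
    have nonpos: "A $$ (j, l) * x l \<le> 0" "L $$ (j, l) * e l \<le> 0" if l: "l < n" for l
      using M_matrix_offdiag[OF hA jk(1) l] M_matrix_offdiag[OF hL jk(1) l] x(1)[OF l] e[OF l] j0
      by (cases "l = j"; auto intro!: mult_nonpos_nonneg)+
    have "(\<Sum>l<n. - (A $$ (j, l) * x l + L $$ (j, l) * e l)) = 0"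
      using null[OF jk(1)] unfolding sum_negf by simp
    moreover have "0 \<le> - (A $$ (j, l) * x l + L $$ (j, l) * e l)" if "l \<in> {..<n}" for l
      using nonpos[of l] that by simp
    ultimately have "- (A $$ (j, k) * x k + L $$ (j, k) * e k) = 0"
      using jk(2) by (intro sum_nonneg_0[of "{..<n}" "\<lambda>l. - (A $$ (j, l) * x l + L $$ (j, l) * e l)"]) auto
    then have "A $$ (j, k) * x k = 0" using nonpos[OF jk(2)] by linarith
    then show False using jk k by simp
  qed
  have "x i \<noteq> 0"
    using acc unfolding has_access_def
  proof (induction rule: converse_rtrancl_induct)
    case base then show ?case using x(2)[OF q] by simp
  next
    case (step j k) then show ?case using pred by blast
  qed
  then show ?thesis using x(3) i by blast
qed

section \<open>Intervals in the block triangular self-partitions\<close>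
lemma order_preserving_partition_fibres:
  assumes mono: "\<And>i j. i \<le> j \<Longrightarrow> j < n \<Longrightarrow> f i \<le> f j"
    and surj: "f ` {..<n} = {..<r}"
  shows "order_preserving_partition n (map (\<lambda>k. {i. i < n \<and> f i = k}) [0..<r])"
  unfolding order_preserving_partition_def
proof (intro conjI allI impI ballI)
  show "{} \<notin> set (map (\<lambda>k. {i. i < n \<and> f i = k}) [0..<r])"
  proof
    assume "{} \<in> set (map (\<lambda>k. {i. i < n \<and> f i = k}) [0..<r])"
    then obtain k where "k < r" "{i. i < n \<and> f i = k} = {}" by auto
    then show False using surj by (metis (mono_tags, lifting) empty_iff imageE lessThan_iff mem_Collect_eq)
  qed
  show "\<Union> (set (map (\<lambda>k. {i. i < n \<and> f i = k}) [0..<r])) = {0..<n}" using surj by auto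
next
  fix k k' i j
  assume "k < length (map (\<lambda>k. {i. i < n \<and> f i = k}) [0..<r])"
    "k' < length (map (\<lambda>k. {i. i < n \<and> f i = k}) [0..<r])"
    "i \<in> map (\<lambda>k. {i. i < n \<and> f i = k}) [0..<r] ! k"
    "j \<in> map (\<lambda>k. {i. i < n \<and> f i = k}) [0..<r] ! k'" "i < j"
  then show "k \<le> k'" using mono[of i j] by auto
qed auto

text \<open>
  The partition into \<open>{a..b}\<close> and singletons refines every member of \<open>PP\<close>, hence also their
  greatest lower bound.
\<close>
lemma interval_encompassed_in_glb:
  assumes PP: "\<And>Y. Y \<in> PP \<Longrightarrow> order_preserving_partition n Y"
    and ab: "a \<le> b" "b < n"
    and blocks: "\<And>Y. Y \<in> PP \<Longrightarrow> \<exists>v\<in>set Y. {a..b} \<subseteq> v"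
  shows "encompasses (partition_glb n PP) {a..b}"
proof -
  \<comment> \<open>Collapses \<open>{a..b}\<close> to \<open>a\<close> and shifts what lies above it down.\<close>
  define f where "f i = (if i < a then i else if i \<le> b then a else i - (b - a))" for i
  define r where "r = n - (b - a)"
  define H where "H = map (\<lambda>k. {i. i < n \<and> f i = k}) [0..<r]"
  have img: "f ` {..<n} = {..<r}"
  proof
    show "f ` {..<n} \<subseteq> {..<r}" using ab unfolding f_def r_def by auto
    show "{..<r} \<subseteq> f ` {..<n}"
    proof
      fix k assume "k \<in> {..<r}"
      then have k: "k < r" by simp
      show "k \<in> f ` {..<n}"
      proof (cases "k \<le> a")
        case True
        then show ?thesis using ab by (intro image_eqI[of _ _ k]) (auto simp: f_def)
      next
        case False
        then show ?thesis using ab k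
          by (intro image_eqI[of _ _ "k + (b - a)"]) (auto simp: f_def r_def)
      qed
    qed
  qed
  have H: "order_preserving_partition n H"
    unfolding H_def by (rule order_preserving_partition_fibres[OF _ img]) (use ab in \<open>auto simp: f_def\<close>)
  have block: "x = {a..b} \<or> (\<exists>i<n. x = {i})" if x: "x \<in> set H" for x
  proof -
    obtain k where k: "k < r" "x = {i. i < n \<and> f i = k}" using x unfolding H_def by auto
    consider "k < a" | "k = a" | "k > a" by linarith
    then show ?thesis
    proof cases
      case 1
      then have "x = {k}" using ab k unfolding f_def by (auto split: if_splits)
      then show ?thesis using 1 ab by auto
    next
      case 2
      then have "x = {a..b}" using ab k unfolding f_def by (auto split: if_splits)
      then show ?thesis by simp
    next
      case 3
      then have "x = {k + (b - a)}" using ab k unfolding f_def r_def by (auto split: if_splits)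
      then show ?thesis using k ab unfolding r_def by auto
    qed
  qed
  have "refinement n H Y" if Y: "Y \<in> PP" for Y
    unfolding refinement_def
  proof (intro conjI ballI)
    fix x assume "x \<in> set H"
    from block[OF this] show "\<exists>y\<in>set Y. x \<subseteq> y"
    proof
      assume "\<exists>i<n. x = {i}"
      then obtain i where "i < n" "x = {i}" by blast
      then show ?thesis using opp_block_of[OF PP[OF Y]] by (metis empty_subsetI insert_subset)
    qed (use blocks[OF Y] in simp)
  qed (use H PP[OF Y] in simp_all)
  then have "refinement n H (partition_glb n PP)"
    using is_partition_glb_partition_glb[OF PP] H unfolding is_partition_glb_def by blast
  moreover have "{a..b} \<in> set H"
  proof -
    have "{a..b} = {i. i < n \<and> f i = a}" using ab unfolding f_def by auto
    moreover have "a < r" using ab unfolding r_def by auto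
    ultimately show ?thesis unfolding H_def by auto
  qed
  ultimately show ?thesis unfolding refinement_def encompasses_def by blast
qed

text \<open>
  A path from \<open>b\<close> down to \<open>q \<le> a\<close> in the graph of \<open>X\<close> cannot cross a boundary between blocks, since
  an edge across it would be a nonzero entry below the block diagonal.
\<close>
lemma interval_in_block_of_upper_partition:
  assumes X: "X \<in> carrier_mat n n" and Y: "order_preserving_partition n Y"
    and cut: "\<forall>v\<in>set Y. \<forall>a\<in>above n v. \<forall>b\<in>v. X $$ (a, b) = 0"
    and acc: "has_access X b q" and qa: "q \<le> a" and ab: "a \<le> b" "b < n"
  shows "\<exists>v\<in>set Y. {a..b} \<subseteq> v"
proof -
  obtain v where v: "v \<in> set Y" "a \<in> v" using opp_block_of[OF Y, of a] ab by auto
  have sub: "w \<subseteq> {0..<n}" if "w \<in> set Y" for w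
    using Y that unfolding order_preserving_partition_def by blast
  have fin: "finite w" if "w \<in> set Y" for w using sub[OF that] finite_subset by blast
  define t where "t = Max v"
  have tv: "t \<in> v" "a \<le> t" using fin[OF v(1)] v(2) Max_in[of v] Max_ge[of v a]
    unfolding t_def by blast+
  have tn: "t < n" using sub[OF v(1)] tv by auto
  have "b \<le> t"
  proof (rule ccontr)
    assume "\<not> b \<le> t"
    have stay: "t < k" if jk: "(j, k) \<in> mat_graph X" "t < j" for j k
    proof (rule ccontr)
      assume "\<not> t < k"
      then have k: "k \<le> t" by simp
      have j: "j < n" "X $$ (j, k) \<noteq> 0" using jk X unfolding mat_graph_def by auto
      obtain w where w: "w \<in> set Y" "k \<in> w" using opp_block_of[OF Y, of k] k tn by auto
      have "Max w \<le> t"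
      proof (rule ccontr)
        assume gt: "\<not> Max w \<le> t"
        have "Max w \<in> w" using fin[OF w(1)] w(2) by (intro Max_in) auto
        then have "t \<in> w" using opp_convex[OF Y w(1) w(2) _ k] gt by simp
        then have "w = v" using opp_blocks_eq[OF Y w(1) v(1)] tv(1) by blast
        then show False using gt unfolding t_def by simp
      qed
      then have "j \<in> above n w" using jk(2) j(1) unfolding above_def by simp
      then show False using cut w j(2) by blast
    qed
    have "t < q"
      using acc unfolding has_access_def
    proof (induction rule: rtrancl_induct)
      case base then show ?case using \<open>\<not> b \<le> t\<close> by simp
    next
      case (step j k) then show ?case using stay by blast
    qed
    then show False using qa tv(2) by simp
  qed
  then have "b \<in> v" using opp_convex[OF Y v(1) v(2) tv(1)] ab(1) by simp
  then have "{a..b} \<subseteq> v" using opp_convex[OF Y v(1) v(2)] by auto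
  then show ?thesis using v(1) by blast
qed

lemma T_set_encompassed:
  assumes hA: "M_matrix n A" and hL: "M_matrix n L" and hU: "M_matrix n U" and A: "A = L * U"
    and S: "S \<in> access_classes A" and Q: "Q \<in> singular_classes U" and QS: "Q \<subseteq> S"
  shows "encompasses (upper_self_partition U) (T_set A S)"
proof -
  note cA = M_matrix_carrier[OF hA] and cU = M_matrix_carrier[OF hU]
  note clS = access_class_props[OF cA S]
  have "Q \<in> access_classes U" using Q unfolding singular_classes_def by simp
  note clQ = access_class_props[OF cU this]
  define a where "a = Max S"
  have aS: "a \<in> S" unfolding a_def using clS(1,3) by (rule Max_in[rotated])
  have an: "a < n" using aS clS(2) by auto
  \<comment> \<open>The set \<open>T_set A S\<close> is contained in the interval from \<open>a = Max S\<close> to the largest vertex with access to \<open>S\<close>.\<close>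
  define J where "J = {j. j < n \<and> a \<le> j \<and> (\<exists>s\<in>S. has_access A j s)}"
  have fin: "finite J" unfolding J_def by simp
  have "a \<in> J" using an aS has_access_refl unfolding J_def by blast
  define b where "b = Max J"
  have bJ: "b \<in> J" unfolding b_def using fin \<open>a \<in> J\<close> by (intro Max_in) auto
  then obtain s where b: "b < n" "a \<le> b" "s \<in> S" "has_access A b s" unfolding J_def by blast
  have T: "T_set A S \<subseteq> {a..b}"
  proof
    fix l assume "l \<in> T_set A S"
    then obtain j where j: "a \<le> l" "l \<le> j" "j < n" "\<exists>s\<in>S. has_access A j s"
      using cA unfolding T_set_def a_def by auto
    then have "j \<in> J" unfolding J_def by simp
    then have "j \<le> b" unfolding b_def using fin by simp
    then show "l \<in> {a..b}" using j by simp
  qed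
  obtain q where q: "q \<in> Q" using clQ(1) by blast
  then have "has_access A b q" using has_access_trans[OF b(4)] clS(4)[OF b(3)] QS by blast
  then obtain p where p: "p \<in> Q" "has_access U b p"
    using access_to_singular_class_of_right_factor[OF hA hL hU A Q q _ b(1)] by blast
  have "p \<le> a" unfolding a_def using p(1) QS clS(3) by (intro Max_ge) auto
  have dim: "dim_row U = n" using cU by simp
  have "encompasses (upper_self_partition U) {a..b}"
    unfolding upper_self_partition_def dim
  proof (rule interval_encompassed_in_glb[OF _ b(2,1)])
    fix Y assume "Y \<in> {Y. order_preserving_partition n Y \<and>
      (\<forall>v\<in>set Y. \<forall>a\<in>above n v. \<forall>b\<in>v. U $$ (a, b) = 0)}"
    then show "\<exists>v\<in>set Y. {a..b} \<subseteq> v"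
      using interval_in_block_of_upper_partition[OF cU _ _ p(2) \<open>p \<le> a\<close> b(2,1)] by blast
  qed simp
  then show ?thesis using T unfolding encompasses_def by blast
qed

section \<open>Transposition and the two encompassing results\<close>
lemma has_access_transpose:
  assumes "X \<in> carrier_mat n n"
  shows "has_access (transpose_mat X) i j \<longleftrightarrow> has_access X j i"
proof -
  have "mat_graph (transpose_mat X) = (mat_graph X)\<inverse>"
    using assms unfolding mat_graph_def by auto
  then show ?thesis unfolding has_access_def by (simp add: rtrancl_converse)
qed

lemma access_classes_transpose:
  assumes "X \<in> carrier_mat n n"
  shows "access_classes (transpose_mat X) = access_classes X"
proof -
  have "transpose_mat X \<in> carrier_mat n n" using assms by simp
  then show ?thesis
    using assms by (auto simp: access_classes_iff has_access_transpose conj_commute)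
qed

lemma singular_classes_transpose:
  assumes X: "X \<in> carrier_mat n n"
  shows "singular_classes (transpose_mat X) = singular_classes X"
proof -
  have "det (submatrix (transpose_mat X) J J) = det (submatrix X J J)" for J
  proof -
    have "submatrix (transpose_mat X) J J = transpose_mat (submatrix X J J)"
      by (rule eq_matI) (use X pick_le in \<open>auto simp: submatrix_def\<close>)
    moreover have "submatrix X J J \<in> carrier_mat (card {i. i < n \<and> i \<in> J}) (card {i. i < n \<and> i \<in> J})"
      using X dim_submatrix[of X J J] by auto
    ultimately show ?thesis using det_transpose by metis
  qed
  then show ?thesis unfolding singular_classes_def access_classes_transpose[OF X] by simp
qed

lemma upper_self_partition_transpose:
  assumes X: "X \<in> carrier_mat n n"
  shows "upper_self_partition (transpose_mat X) = lower_self_partition X"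
proof -
  have "(\<forall>v\<in>set Y. \<forall>a\<in>above n v. \<forall>b\<in>v. transpose_mat X $$ (a, b) = 0) \<longleftrightarrow>
        (\<forall>v\<in>set Y. \<forall>a\<in>v. \<forall>b\<in>above n v. X $$ (a, b) = 0)"
    if Y: "order_preserving_partition n Y" for Y
  proof -
    have "transpose_mat X $$ (a, b) = X $$ (b, a)" if "v \<in> set Y" "a \<in> above n v" "b \<in> v" for v a b
    proof -
      have "v \<subseteq> {0..<n}" using Y that(1) unfolding order_preserving_partition_def by blast
      then show ?thesis using that X unfolding above_def by auto
    qed
    then show ?thesis by (metis (no_types, lifting))
  qed
  then have "{Y. order_preserving_partition n Y \<and>
         (\<forall>v\<in>set Y. \<forall>a\<in>above n v. \<forall>b\<in>v. transpose_mat X $$ (a, b) = 0)} =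
      {Y. order_preserving_partition n Y \<and>
         (\<forall>v\<in>set Y. \<forall>a\<in>v. \<forall>b\<in>above n v. X $$ (a, b) = 0)}" by blast
  then show ?thesis using X unfolding upper_self_partition_def lower_self_partition_def by simp
qed

lemma F_set_encompassed:
  assumes hA: "M_matrix n A" and hL: "M_matrix n L" and hU: "M_matrix n U" and A: "A = L * U"
    and S: "S \<in> access_classes A" and Q: "Q \<in> singular_classes L" and QS: "Q \<subseteq> S"
  shows "encompasses (lower_self_partition L) (F_set A S)"
proof -
  note cA = M_matrix_carrier[OF hA] and cL = M_matrix_carrier[OF hL] and cU = M_matrix_carrier[OF hU]
  have "T_set (transpose_mat A) S = F_set A S"
    using cA unfolding T_set_def F_set_def by (simp add: has_access_transpose)
  moreover have "transpose_mat A = transpose_mat U * transpose_mat L"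
    unfolding A using transpose_mult[OF cL cU] by simp
  ultimately show ?thesis
    using T_set_encompassed[OF M_matrix_transpose[OF hA] M_matrix_transpose[OF hU]
        M_matrix_transpose[OF hL], of S Q] S Q QS
      upper_self_partition_transpose[OF cL] singular_classes_transpose[OF cL]
      access_classes_transpose[OF cA] by metis
qed

theorem theorem3p5:
  fixes n m :: nat and A L U :: "real mat" and S :: "nat \<Rightarrow> nat set"
  assumes "M_matrix n A" and "M_matrix n L" and "M_matrix n U"
    and "A = L * U"
    and "bij_betw S {1..m} (singular_classes A)"
    and "\<forall>i\<in>{1..<m}. Max (S i) < Max (S (Suc i))"
  shows "\<forall>i\<in>{1..m}.
    (\<exists>Q. Q \<subseteq> S i \<and> (Q \<in> singular_classes L \<or> Q \<in> singular_classes U)) \<and>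
    (\<forall>Q. Q \<subseteq> S i \<longrightarrow>
      (Q \<in> singular_classes L \<longrightarrow> encompasses (lower_self_partition L) (F_set A (S i))) \<and>
      (Q \<in> singular_classes U \<longrightarrow> encompasses (upper_self_partition U) (T_set A (S i))))"
proof
  fix i assume "i \<in> {1..m}"
  then have S: "S i \<in> singular_classes A" using assms(5) bij_betwE by blast
  then have "S i \<in> access_classes A" unfolding singular_classes_def by simp
  then show "(\<exists>Q. Q \<subseteq> S i \<and> (Q \<in> singular_classes L \<or> Q \<in> singular_classes U)) \<and>
    (\<forall>Q. Q \<subseteq> S i \<longrightarrow>
      (Q \<in> singular_classes L \<longrightarrow> encompasses (lower_self_partition L) (F_set A (S i))) \<and>
      (Q \<in> singular_classes U \<longrightarrow> encompasses (upper_self_partition U) (T_set A (S i))))"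
    using singular_class_of_some_factor[OF assms(1-4) S] F_set_encompassed[OF assms(1-4)]
      T_set_encompassed[OF assms(1-4)] by blast
qed

end
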